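(* Let $G$ be a Cayley graph of a finitely generated group $\Gamma$. Let $\eta$ be a $\Gamma$-invariant, ergodic random labelling of $G$, and let $\omega$ be an $\eta$-measurable site or bond percolation on $G$ such that $(\eta,\omega)$ is jointly $\Gamma$-invariant. Then there are no nontrivial component (cluster) properties for $\omega$ that are not essentially tail.
   Context: **Setting.** $\Gamma$ is identified with $V(G)$, with identity $o$; $G$ is the left Cayley graph with respect to a finite generating set, and $\Gamma$ acts on $G$ by the automorphisms $g\cdot x=xg^{-1}$. A labelling is an assignment of elements of a fixed Polish space $L$ to the vertices (or edges, or both) of $G$. The percolation $\omega$ is a measurable function of $\eta$; its clusters are its connected components. **Component property.** A measurable set $\mathscr A$ of pairs $(\eta,v)$ (a labelling and a vertex) that is invariant under the diagonal action of $\Gamma$ and such that, for $v,w$ in the same cluster of the percolation $\omega$ determined by $\eta$, $(\eta,v)\in\mathscr A$ iff $(\eta,w)\in\mathscr A$. A vertex $v$ (or its cluster) has type $\mathscr A$ if $(\eta,v)\in\mathscr A$. A component property is nontrivial if $\{(\eta,o)\in\mathscr A\}$ has conditional probability strictly between $0$ and $1$ given that the cluster of $o$ is infinite. **Tail component property.** A component property $\mathscr A$ such that, whenever $\omega$ and $\omega'$ are two percolation configurations with environments $\eta$ and $\eta'$, where $\eta$ and $\eta'$ differ only at finitely many sites or edges, and the clusters of $o$ in $\omega$ and in $\omega'$ are infinite and have a finite symmetric difference, then either $o$ has type $\mathscr A$ in both $\omega$ and $\omega'$, or in neither. **Essentially tail.** A component property $\mathscr A$ is essentially tail if there exists a tail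 component property $\mathscr A'$ with $\mathbb P\big(\{(\eta,x)\in\mathscr A\}\bigtriangleup\{(\eta,x)\in\mathscr A'\}\big)=0$ for a vertex $x$ (equivalently, by invariance, for all vertices $x$). *)

theory Defs
  imports "HOL-Probability.Probability" "HOL-Algebra.Generated_Groups"
begin

section \<open>Cayley graphs, labellings and percolation configurations\<close>

datatype 'a element = Vertex 'a | Edge "'a set"

text \<open>The left Cayley graph, as a simple undirected graph on \<^term>\<open>carrier \<Gamma>\<close>: the edges are the
  two-element sets \<open>{x, s x}\<close>. The generating set need not be symmetric, and a trivial generator
  contributes no loop.\<close>

definition cayley_edges :: "('a, 'b) monoid_scheme \<Rightarrow> 'a set \<Rightarrow> 'a set set" where
  "cayley_edges \<Gamma> S = {{x, s \<otimes>\<^bsub>\<Gamma>\<^esub> x} | x s. x \<in> carrier \<Gamma> \<and> s \<in> S \<and> s \<noteq> \<one>\<^bsub>\<Gamma>\<^esub>}"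

definition sites :: "('a, 'b) monoid_scheme \<Rightarrow> 'a element set" where
  "sites \<Gamma> = Vertex ` carrier \<Gamma>"

definition bonds :: "('a, 'b) monoid_scheme \<Rightarrow> 'a set \<Rightarrow> 'a element set" where
  "bonds \<Gamma> S = Edge ` cayley_edges \<Gamma> S"

definition act_vertex :: "('a, 'b) monoid_scheme \<Rightarrow> 'a \<Rightarrow> 'a \<Rightarrow> 'a" where
  "act_vertex \<Gamma> g x = x \<otimes>\<^bsub>\<Gamma>\<^esub> inv\<^bsub>\<Gamma>\<^esub> g"

primrec act_element :: "('a, 'b) monoid_scheme \<Rightarrow> 'a \<Rightarrow> 'a element \<Rightarrow> 'a element" where
  "act_element \<Gamma> g (Vertex x) = Vertex (act_vertex \<Gamma> g x)"
| "act_element \<Gamma> g (Edge e) = Edge (act_vertex \<Gamma> g ` e)"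

text \<open>A labelling with label domain \<open>J\<close> (sites, bonds, or both) is an element of the product
  \<open>L\<^sup>J\<close>, that is, a function extensional on \<open>J\<close>. A percolation configuration is a 0-1 labelling of
  \<open>I\<close> (sites or bonds), \<^term>\<open>True\<close> meaning open.\<close>

definition labellings :: "'a element set \<Rightarrow> ('a element \<Rightarrow> 'l::polish_space) measure" where
  "labellings J = (\<Pi>\<^sub>M i\<in>J. borel)"

definition configurations :: "'a element set \<Rightarrow> ('a element \<Rightarrow> bool) measure" where
  "configurations I = (\<Pi>\<^sub>M i\<in>I. count_space UNIV)"

text \<open>The induced action on labellings and configurations: \<open>(g \<cdot> f) i = f (g\<inverse> \<cdot> i)\<close>.\<close>

definition translate ::
  "('a, 'b) monoid_scheme \<Rightarrow> 'a element set \<Rightarrow> 'a \<Rightarrow> ('a element \<Rightarrow> 'c) \<Rightarrow> ('a element \<Rightarrow> 'c)" where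
  "translate \<Gamma> J g f = (\<lambda>i\<in>J. f (act_element \<Gamma> (inv\<^bsub>\<Gamma>\<^esub> g) i))"


section \<open>Clusters\<close>

text \<open>Elements outside \<open>I\<close> count as open: in bond percolation all vertices are present, and in site
  percolation an edge is present iff both of its endpoints are open.\<close>

definition is_open :: "'a element set \<Rightarrow> ('a element \<Rightarrow> bool) \<Rightarrow> 'a element \<Rightarrow> bool" where
  "is_open I w i \<longleftrightarrow> (i \<in> I \<longrightarrow> w i)"

definition open_adjacent ::
  "('a, 'b) monoid_scheme \<Rightarrow> 'a set \<Rightarrow> 'a element set \<Rightarrow> ('a element \<Rightarrow> bool) \<Rightarrow> 'a \<Rightarrow> 'a \<Rightarrow> bool" where
  "open_adjacent \<Gamma> S I w x y \<longleftrightarrow> {x, y} \<in> cayley_edges \<Gamma> S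
     \<and> is_open I w (Vertex x) \<and> is_open I w (Vertex y) \<and> is_open I w (Edge {x, y})"

text \<open>The vertex set of the cluster of \<open>x\<close>; it is empty if \<open>x\<close> is a closed site.\<close>

definition cluster ::
  "('a, 'b) monoid_scheme \<Rightarrow> 'a set \<Rightarrow> 'a element set \<Rightarrow> ('a element \<Rightarrow> bool) \<Rightarrow> 'a \<Rightarrow> 'a set" where
  "cluster \<Gamma> S I w x =
     {y \<in> carrier \<Gamma>. is_open I w (Vertex x) \<and> (open_adjacent \<Gamma> S I w)\<^sup>*\<^sup>* x y}"


section \<open>Random labellings and percolations determined by them\<close>

definition invariant_labelling ::
  "('a, 'b) monoid_scheme \<Rightarrow> 'a element set \<Rightarrow> 'm measure \<Rightarrow>
     ('m \<Rightarrow> 'a element \<Rightarrow> 'l::polish_space) \<Rightarrow> bool" where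
  "invariant_labelling \<Gamma> J M \<eta> \<longleftrightarrow>
     (\<forall>g\<in>carrier \<Gamma>. distr M (labellings J) (\<lambda>s. translate \<Gamma> J g (\<eta> s))
        = distr M (labellings J) \<eta>)"

definition ergodic_labelling ::
  "('a, 'b) monoid_scheme \<Rightarrow> 'a element set \<Rightarrow> 'm measure \<Rightarrow>
     ('m \<Rightarrow> 'a element \<Rightarrow> 'l::polish_space) \<Rightarrow> bool" where
  "ergodic_labelling \<Gamma> J M \<eta> \<longleftrightarrow>
     (\<forall>B\<in>sets (labellings J).
        (\<forall>g\<in>carrier \<Gamma>. \<forall>h\<in>space (labellings J). translate \<Gamma> J g h \<in> B \<longleftrightarrow> h \<in> B) \<longrightarrow>
        \<P>(s in M. \<eta> s \<in> B) = 0 \<or> \<P>(s in M. \<eta> s \<in> B) = 1)"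

definition jointly_invariant ::
  "('a, 'b) monoid_scheme \<Rightarrow> 'a element set \<Rightarrow> 'a element set \<Rightarrow> 'm measure \<Rightarrow>
     ('m \<Rightarrow> 'a element \<Rightarrow> 'l::polish_space) \<Rightarrow> ('m \<Rightarrow> 'a element \<Rightarrow> bool) \<Rightarrow> bool" where
  "jointly_invariant \<Gamma> J I M \<eta> \<omega> \<longleftrightarrow>
     (\<forall>g\<in>carrier \<Gamma>.
        distr M (labellings J \<Otimes>\<^sub>M configurations I)
          (\<lambda>s. (translate \<Gamma> J g (\<eta> s), translate \<Gamma> I g (\<omega> s)))
        = distr M (labellings J \<Otimes>\<^sub>M configurations I) (\<lambda>s. (\<eta> s, \<omega> s)))"

text \<open>\<open>\<Phi>\<close> represents \<open>\<omega>\<close> as a measurable function of \<open>\<eta>\<close>. Component properties speak about the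
  percolation determined by \<^emph>\<open>every\<close> environment, so a representative defined on all labellings has
  to be chosen. It is taken to commute with the action. For jointly invariant \<open>(\<eta>, \<omega>)\<close> this is no
  restriction on \<open>\<omega>\<close>: any measurable representative commutes with the action almost surely, and can
  be made equivariant by changing it on a null set (\<open>equivariant_representative_exists\<close>
  below).\<close>

definition equivariant_representative ::
  "('a, 'b) monoid_scheme \<Rightarrow> 'a element set \<Rightarrow> 'a element set \<Rightarrow> 'm measure \<Rightarrow>
     ('m \<Rightarrow> 'a element \<Rightarrow> 'l::polish_space) \<Rightarrow> ('m \<Rightarrow> 'a element \<Rightarrow> bool) \<Rightarrow>
     (('a element \<Rightarrow> 'l) \<Rightarrow> 'a element \<Rightarrow> bool) \<Rightarrow> bool" where
  "equivariant_representative \<Gamma> J I M \<eta> \<omega> \<Phi> \<longleftrightarrow>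
     \<Phi> \<in> labellings J \<rightarrow>\<^sub>M configurations I
     \<and> (AE s in M. \<omega> s = \<Phi> (\<eta> s))
     \<and> (\<forall>g\<in>carrier \<Gamma>. \<forall>h\<in>space (labellings J). \<Phi> (translate \<Gamma> J g h) = translate \<Gamma> I g (\<Phi> h))"


section \<open>Component properties\<close>

definition component_property ::
  "('a, 'b) monoid_scheme \<Rightarrow> 'a set \<Rightarrow> 'a element set \<Rightarrow> 'a element set \<Rightarrow>
     (('a element \<Rightarrow> 'l::polish_space) \<Rightarrow> 'a element \<Rightarrow> bool) \<Rightarrow>
     (('a element \<Rightarrow> 'l) \<times> 'a) set \<Rightarrow> bool" where
  "component_property \<Gamma> S J I \<Phi> A \<longleftrightarrow>
     A \<in> sets (labellings J \<Otimes>\<^sub>M count_space (carrier \<Gamma>))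
     \<and> (\<forall>g\<in>carrier \<Gamma>. \<forall>h\<in>space (labellings J). \<forall>v\<in>carrier \<Gamma>.
          (translate \<Gamma> J g h, act_vertex \<Gamma> g v) \<in> A \<longleftrightarrow> (h, v) \<in> A)
     \<and> (\<forall>h\<in>space (labellings J). \<forall>v\<in>carrier \<Gamma>. \<forall>w\<in>cluster \<Gamma> S I (\<Phi> h) v.
          (h, v) \<in> A \<longleftrightarrow> (h, w) \<in> A)"

text \<open>If the cluster of the identity is almost surely finite, the conditional probability is
  \<open>0 / 0 = 0\<close> and no property is nontrivial.\<close>

definition nontrivial_property ::
  "('a, 'b) monoid_scheme \<Rightarrow> 'a set \<Rightarrow> 'a element set \<Rightarrow> 'm measure \<Rightarrow>
     ('m \<Rightarrow> 'a element \<Rightarrow> 'l::polish_space) \<Rightarrow> ('m \<Rightarrow> 'a element \<Rightarrow> bool) \<Rightarrow>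
     (('a element \<Rightarrow> 'l) \<times> 'a) set \<Rightarrow> bool" where
  "nontrivial_property \<Gamma> S I M \<eta> \<omega> A \<longleftrightarrow>
     0 < \<P>(s in M. (\<eta> s, \<one>\<^bsub>\<Gamma>\<^esub>) \<in> A \<bar> infinite (cluster \<Gamma> S I (\<omega> s) \<one>\<^bsub>\<Gamma>\<^esub>))
     \<and> \<P>(s in M. (\<eta> s, \<one>\<^bsub>\<Gamma>\<^esub>) \<in> A \<bar> infinite (cluster \<Gamma> S I (\<omega> s) \<one>\<^bsub>\<Gamma>\<^esub>)) < 1"

definition tail_component_property ::
  "('a, 'b) monoid_scheme \<Rightarrow> 'a set \<Rightarrow> 'a element set \<Rightarrow> 'a element set \<Rightarrow>
     (('a element \<Rightarrow> 'l::polish_space) \<Rightarrow> 'a element \<Rightarrow> bool) \<Rightarrow>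
     (('a element \<Rightarrow> 'l) \<times> 'a) set \<Rightarrow> bool" where
  "tail_component_property \<Gamma> S J I \<Phi> A \<longleftrightarrow>
     component_property \<Gamma> S J I \<Phi> A
     \<and> (\<forall>h\<in>space (labellings J). \<forall>h'\<in>space (labellings J).
          let C = cluster \<Gamma> S I (\<Phi> h) \<one>\<^bsub>\<Gamma>\<^esub>; C' = cluster \<Gamma> S I (\<Phi> h') \<one>\<^bsub>\<Gamma>\<^esub> in
          finite {i\<in>J. h i \<noteq> h' i} \<and> infinite C \<and> infinite C' \<and> finite ((C - C') \<union> (C' - C)) \<longrightarrow>
          ((h, \<one>\<^bsub>\<Gamma>\<^esub>) \<in> A \<longleftrightarrow> (h', \<one>\<^bsub>\<Gamma>\<^esub>) \<in> A))"

definition essentially_tail ::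
  "('a, 'b) monoid_scheme \<Rightarrow> 'a set \<Rightarrow> 'a element set \<Rightarrow> 'a element set \<Rightarrow> 'm measure \<Rightarrow>
     ('m \<Rightarrow> 'a element \<Rightarrow> 'l::polish_space) \<Rightarrow>
     (('a element \<Rightarrow> 'l) \<Rightarrow> 'a element \<Rightarrow> bool) \<Rightarrow>
     (('a element \<Rightarrow> 'l) \<times> 'a) set \<Rightarrow> bool" where
  "essentially_tail \<Gamma> S J I M \<eta> \<Phi> A \<longleftrightarrow>
     (\<exists>A'. tail_component_property \<Gamma> S J I \<Phi> A'
        \<and> (\<forall>x\<in>carrier \<Gamma>. \<P>(s in M. (\<eta> s, x) \<in> (A - A') \<union> (A' - A)) = 0))"


section \<open>Existence of equivariant representatives\<close>

lemma countable_generate: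
  assumes "countable S"
  shows "countable (generate G S)"
proof -
  define step where "step X = X \<union> (\<lambda>(a, b). a \<otimes>\<^bsub>G\<^esub> b) ` (X \<times> X)" for X
  define C where "C n = (step ^^ n) ({\<one>\<^bsub>G\<^esub>} \<union> S \<union> m_inv G ` S)" for n
  have C_Suc: "C (Suc n) = step (C n)" for n
    by (simp add: C_def)
  have cnt: "countable (C n)" for n
  proof (induction n)
    case 0
    show ?case using assms by (simp add: C_def)
  next
    case (Suc n)
    then show ?case by (simp add: C_Suc step_def)
  qed
  have mono: "C m \<subseteq> C n" if "m \<le> n" for m n
    by (rule lift_Suc_mono_le[OF _ that]) (simp add: C_Suc step_def)
  have "x \<in> (\<Union>n. C n)" if "x \<in> generate G S" for x
    using that
  proof induction
    case one
    have "\<one>\<^bsub>G\<^esub> \<in> C 0" by (simp add: C_def)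
    then show ?case by blast
  next
    case (incl h)
    then have "h \<in> C 0" by (simp add: C_def)
    then show ?case by blast
  next
    case (inv h)
    then have "inv\<^bsub>G\<^esub> h \<in> C 0" by (simp add: C_def)
    then show ?case by blast
  next
    case (eng a b)
    then obtain m n where "a \<in> C m" "b \<in> C n" by blast
    then have "a \<in> C (max m n)" "b \<in> C (max m n)"
      using mono[of m "max m n"] mono[of n "max m n"] by auto
    then have "a \<otimes>\<^bsub>G\<^esub> b \<in> C (Suc (max m n))"
      unfolding C_Suc step_def by auto
    then show ?case by blast
  qed
  then have "generate G S \<subseteq> (\<Union>n. C n)" by (rule subsetI)
  moreover have "countable (\<Union>n. C n)"
    by (intro countable_UN countableI_type cnt)
  ultimately show ?thesis
    by (rule countable_subset)
qed

lemma countable_elements: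
  assumes "finite S" "generate \<Gamma> S = carrier \<Gamma>"
  shows "countable (carrier \<Gamma>)" "countable (sites \<Gamma> \<union> bonds \<Gamma> S)"
proof -
  show c: "countable (carrier \<Gamma>)"
    using countable_generate[OF countable_finite[OF assms(1)], of \<Gamma>] assms(2) by simp
  have "cayley_edges \<Gamma> S \<subseteq> (\<lambda>(x, s). {x, s \<otimes>\<^bsub>\<Gamma>\<^esub> x}) ` (carrier \<Gamma> \<times> S)"
    unfolding cayley_edges_def by auto
  then have "countable (cayley_edges \<Gamma> S)"
    by (rule countable_subset)
      (intro countable_image countable_SIGMA c countable_finite[OF assms(1)])
  then show "countable (sites \<Gamma> \<union> bonds \<Gamma> S)"
    using c by (simp add: sites_def bonds_def)
qed

lemma act_element_closed:
  assumes "group \<Gamma>" "S \<subseteq> carrier \<Gamma>" "g \<in> carrier \<Gamma>"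
  shows "i \<in> sites \<Gamma> \<Longrightarrow> act_element \<Gamma> g i \<in> sites \<Gamma>"
    and "i \<in> bonds \<Gamma> S \<Longrightarrow> act_element \<Gamma> g i \<in> bonds \<Gamma> S"
proof -
  interpret group \<Gamma> by fact
  show "act_element \<Gamma> g i \<in> sites \<Gamma>" if "i \<in> sites \<Gamma>"
    using that assms by (auto simp: sites_def act_vertex_def)
  show "act_element \<Gamma> g i \<in> bonds \<Gamma> S" if "i \<in> bonds \<Gamma> S"
  proof -
    from that obtain x s where xs: "i = Edge {x, s \<otimes>\<^bsub>\<Gamma>\<^esub> x}" "x \<in> carrier \<Gamma>" "s \<in> S" "s \<noteq> \<one>\<^bsub>\<Gamma>\<^esub>"
      by (auto simp: bonds_def cayley_edges_def)
    then have s: "s \<in> carrier \<Gamma>" using assms(2) by blast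
    have "act_vertex \<Gamma> g ` {x, s \<otimes>\<^bsub>\<Gamma>\<^esub> x} = {x \<otimes>\<^bsub>\<Gamma>\<^esub> inv\<^bsub>\<Gamma>\<^esub> g, s \<otimes>\<^bsub>\<Gamma>\<^esub> (x \<otimes>\<^bsub>\<Gamma>\<^esub> inv\<^bsub>\<Gamma>\<^esub> g)}"
      using xs(2) s assms(3) by (simp add: act_vertex_def m_assoc)
    moreover have "x \<otimes>\<^bsub>\<Gamma>\<^esub> inv\<^bsub>\<Gamma>\<^esub> g \<in> carrier \<Gamma>"
      using xs(2) assms(3) by simp
    ultimately have "act_vertex \<Gamma> g ` {x, s \<otimes>\<^bsub>\<Gamma>\<^esub> x} \<in> cayley_edges \<Gamma> S"
      unfolding cayley_edges_def using xs(3,4) by blast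
    then show ?thesis
      by (simp add: xs(1) bonds_def)
  qed
qed

lemma act_element_mult:
  assumes "group \<Gamma>" "S \<subseteq> carrier \<Gamma>" "g \<in> carrier \<Gamma>" "k \<in> carrier \<Gamma>"
    and "i \<in> sites \<Gamma> \<union> bonds \<Gamma> S"
  shows "act_element \<Gamma> g (act_element \<Gamma> k i) = act_element \<Gamma> (g \<otimes>\<^bsub>\<Gamma>\<^esub> k) i"
proof -
  interpret group \<Gamma> by fact
  have v: "act_vertex \<Gamma> g (act_vertex \<Gamma> k x) = act_vertex \<Gamma> (g \<otimes>\<^bsub>\<Gamma>\<^esub> k) x" if "x \<in> carrier \<Gamma>" for x
    using that assms by (simp add: act_vertex_def m_assoc inv_mult_group)
  have "e \<subseteq> carrier \<Gamma>" if "e \<in> cayley_edges \<Gamma> S" for e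
    using that assms by (auto simp: cayley_edges_def)
  then have "act_vertex \<Gamma> g ` act_vertex \<Gamma> k ` e = act_vertex \<Gamma> (g \<otimes>\<^bsub>\<Gamma>\<^esub> k) ` e"
    if "e \<in> cayley_edges \<Gamma> S" for e
    unfolding image_image using that v by (intro image_cong) auto
  then show ?thesis
    using assms(5) v by (auto simp: sites_def bonds_def)
qed

lemma translate_mult:
  assumes "group \<Gamma>" "S \<subseteq> carrier \<Gamma>" "g \<in> carrier \<Gamma>" "k \<in> carrier \<Gamma>"
    and "J \<subseteq> sites \<Gamma> \<union> bonds \<Gamma> S" "\<And>g i. g \<in> carrier \<Gamma> \<Longrightarrow> i \<in> J \<Longrightarrow> act_element \<Gamma> g i \<in> J"
  shows "translate \<Gamma> J g (translate \<Gamma> J k f) = translate \<Gamma> J (g \<otimes>\<^bsub>\<Gamma>\<^esub> k) f"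
proof -
  interpret group \<Gamma> by fact
  show ?thesis
  proof
    fix i
    show "translate \<Gamma> J g (translate \<Gamma> J k f) i = translate \<Gamma> J (g \<otimes>\<^bsub>\<Gamma>\<^esub> k) f i"
    proof (cases "i \<in> J")
      case True
      then have "act_element \<Gamma> (inv\<^bsub>\<Gamma>\<^esub> k) (act_element \<Gamma> (inv\<^bsub>\<Gamma>\<^esub> g) i)
          = act_element \<Gamma> (inv\<^bsub>\<Gamma>\<^esub> k \<otimes>\<^bsub>\<Gamma>\<^esub> inv\<^bsub>\<Gamma>\<^esub> g) i"
        using assms by (intro act_element_mult[OF assms(1,2)]) auto
      then show ?thesis
        using True assms(3,4,6) by (simp add: translate_def inv_mult_group)
    qed (simp add: translate_def)
  qed
qed

lemma measurable_translate:
  assumes "group \<Gamma>" "g \<in> carrier \<Gamma>"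
    and "\<And>g i. g \<in> carrier \<Gamma> \<Longrightarrow> i \<in> J \<Longrightarrow> act_element \<Gamma> g i \<in> J"
  shows "translate \<Gamma> J g \<in> (\<Pi>\<^sub>M i\<in>J. K) \<rightarrow>\<^sub>M (\<Pi>\<^sub>M i\<in>J. K)"
proof -
  interpret group \<Gamma> by fact
  show ?thesis
    unfolding translate_def
    by (intro measurable_restrict measurable_component_singleton) (use assms in auto)
qed

lemma pred_ball_countable:
  assumes "countable I" "\<And>i. i \<in> I \<Longrightarrow> Measurable.pred N (P i)"
  shows "Measurable.pred N (\<lambda>x. \<forall>i\<in>I. P i x)"
proof (cases "I = {}")
  case False
  have "(\<Inter>i\<in>I. {x \<in> space N. P i x}) \<in> sets N"
    using assms(2) by (intro sets.countable_INT'[OF assms(1) False]) (auto simp: pred_def)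
  also have "(\<Inter>i\<in>I. {x \<in> space N. P i x}) = {x \<in> space N. \<forall>i\<in>I. P i x}"
    using False by auto
  finally show ?thesis
    by (simp add: pred_def)
qed simp

lemma pred_eq_configurations:
  assumes "countable I" "f \<in> N \<rightarrow>\<^sub>M configurations I" "g \<in> N \<rightarrow>\<^sub>M configurations I"
  shows "Measurable.pred N (\<lambda>x. f x = g x)"
proof -
  have c: "(\<lambda>x. h x i) \<in> N \<rightarrow>\<^sub>M count_space UNIV"
    if "h \<in> N \<rightarrow>\<^sub>M configurations I" "i \<in> I" for h i
    using measurable_compose[OF that(1)[unfolded configurations_def]
        measurable_component_singleton[OF that(2)]] .
  have "Measurable.pred N (\<lambda>x. f x i = g x i)" if "i \<in> I" for i
  proof -
    note [measurable] = c[OF assms(2) that] c[OF assms(3) that]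
    show ?thesis by measurable
  qed
  then have "Measurable.pred N (\<lambda>x. \<forall>i\<in>I. f x i = g x i)"
    by (rule pred_ball_countable[OF assms(1)])
  moreover have "f x = g x \<longleftrightarrow> (\<forall>i\<in>I. f x i = g x i)" if "x \<in> space N" for x
  proof -
    have "f x \<in> extensional I" "g x \<in> extensional I"
      using measurable_space[OF assms(2) that] measurable_space[OF assms(3) that]
      by (auto simp: configurations_def space_PiM PiE_def)
    then show ?thesis
      by (auto intro: extensionalityI)
  qed
  ultimately show ?thesis
    by (subst measurable_cong) auto
qed

lemma equivariant_representative_exists:
  fixes \<eta> :: "'m \<Rightarrow> 'a element \<Rightarrow> 'l::polish_space"
  assumes grp: "group \<Gamma>" and S: "finite S" "S \<subseteq> carrier \<Gamma>" "generate \<Gamma> S = carrier \<Gamma>"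
    and J: "J \<in> {sites \<Gamma>, bonds \<Gamma> S, sites \<Gamma> \<union> bonds \<Gamma> S}"
    and I: "I \<in> {sites \<Gamma>, bonds \<Gamma> S}"
    and \<eta>: "\<eta> \<in> M \<rightarrow>\<^sub>M labellings J" and \<omega>: "\<omega> \<in> M \<rightarrow>\<^sub>M configurations I"
    and inv: "jointly_invariant \<Gamma> J I M \<eta> \<omega>"
    and \<phi>: "\<phi> \<in> labellings J \<rightarrow>\<^sub>M configurations I" and eq: "AE s in M. \<omega> s = \<phi> (\<eta> s)"
  shows "\<exists>\<Phi>. equivariant_representative \<Gamma> J I M \<eta> \<omega> \<Phi>"
proof -
  interpret group \<Gamma> by fact
  have Jsub: "J \<subseteq> sites \<Gamma> \<union> bonds \<Gamma> S" and Isub: "I \<subseteq> sites \<Gamma> \<union> bonds \<Gamma> S"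
    using I J by auto
  have Icl: "act_element \<Gamma> g i \<in> I" if "g \<in> carrier \<Gamma>" "i \<in> I" for g i
    using I act_element_closed[OF grp S(2) that(1)] that(2) by auto
  have Jcl: "act_element \<Gamma> g i \<in> J" if "g \<in> carrier \<Gamma>" "i \<in> J" for g i
    using J act_element_closed[OF grp S(2) that(1)] that(2) by auto
  have cI: "countable I"
    using countable_elements(2)[OF S(1,3)] Isub by (rule countable_subset[rotated])
  have cG: "countable (carrier \<Gamma>)"
    by (rule countable_elements(1)[OF S(1,3)])
  have tJ: "translate \<Gamma> J g \<in> labellings J \<rightarrow>\<^sub>M (labellings J :: ('a element \<Rightarrow> 'l) measure)"
    if "g \<in> carrier \<Gamma>" for g
    unfolding labellings_def by (rule measurable_translate[OF grp that]) (rule Jcl)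
  have tI: "translate \<Gamma> I g \<in> configurations I \<rightarrow>\<^sub>M configurations I" if "g \<in> carrier \<Gamma>" for g
    unfolding configurations_def by (rule measurable_translate[OF grp that]) (rule Icl)
  have mJ: "translate \<Gamma> J g (translate \<Gamma> J k f) = translate \<Gamma> J (g \<otimes>\<^bsub>\<Gamma>\<^esub> k) f"
    if "g \<in> carrier \<Gamma>" "k \<in> carrier \<Gamma>" for g k and f :: "'a element \<Rightarrow> 'l"
    by (rule translate_mult[OF grp S(2) that Jsub]) (rule Jcl)
  have mI: "translate \<Gamma> I g (translate \<Gamma> I k f) = translate \<Gamma> I (g \<otimes>\<^bsub>\<Gamma>\<^esub> k) f"
    if "g \<in> carrier \<Gamma>" "k \<in> carrier \<Gamma>" for g k and f :: "'a element \<Rightarrow> bool"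
    by (rule translate_mult[OF grp S(2) that Isub]) (rule Icl)
  define good where
    "good h \<longleftrightarrow> (\<forall>g\<in>carrier \<Gamma>. \<phi> (translate \<Gamma> J g h) = translate \<Gamma> I g (\<phi> h))" for h
  define \<Phi> where "\<Phi> h = (if good h then \<phi> h else (\<lambda>i\<in>I. False))" for h
  have good_pred: "Measurable.pred (labellings J) good"
    unfolding good_def
    by (intro pred_ball_countable cG pred_eq_configurations[OF cI]
        measurable_compose[OF tJ \<phi>] measurable_compose[OF \<phi> tI])
  have "\<Phi> \<in> labellings J \<rightarrow>\<^sub>M configurations I"
    unfolding \<Phi>_def
    by (intro measurable_If[OF \<phi> measurable_const] good_pred[unfolded pred_def])
      (auto simp: configurations_def space_PiM)
  moreover have "AE s in M. \<omega> s = \<Phi> (\<eta> s)"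
  proof -
    have "AE s in M. \<phi> (translate \<Gamma> J g (\<eta> s)) = translate \<Gamma> I g (\<phi> (\<eta> s))"
      if g: "g \<in> carrier \<Gamma>" for g
    proof -
      let ?P = "labellings J \<Otimes>\<^sub>M configurations I :: (('a element \<Rightarrow> 'l) \<times> _) measure"
      have D: "Measurable.pred ?P (\<lambda>p. snd p = \<phi> (fst p))"
        by (rule pred_eq_configurations[OF cI measurable_snd measurable_compose[OF measurable_fst \<phi>]])
      have m1: "(\<lambda>s. (\<eta> s, \<omega> s)) \<in> M \<rightarrow>\<^sub>M ?P"
        using \<eta> \<omega> by (rule measurable_Pair)
      have m2: "(\<lambda>s. (translate \<Gamma> J g (\<eta> s), translate \<Gamma> I g (\<omega> s))) \<in> M \<rightarrow>\<^sub>M ?P"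
        by (rule measurable_Pair[OF measurable_compose[OF \<eta> tJ[OF g]] measurable_compose[OF \<omega> tI[OF g]]])
      have "AE p in distr M ?P (\<lambda>s. (\<eta> s, \<omega> s)). snd p = \<phi> (fst p)"
        using eq by (subst AE_distr_iff[OF m1 D[unfolded pred_def]]) simp
      then have "AE p in distr M ?P (\<lambda>s. (translate \<Gamma> J g (\<eta> s), translate \<Gamma> I g (\<omega> s))).
          snd p = \<phi> (fst p)"
        by (subst inv[unfolded jointly_invariant_def, THEN bspec, OF g])
      then have "AE s in M. translate \<Gamma> I g (\<omega> s) = \<phi> (translate \<Gamma> J g (\<eta> s))"
        by (subst (asm) AE_distr_iff[OF m2 D[unfolded pred_def]]) simp
      with eq show ?thesis
        by eventually_elim simp
    qed
    then have "AE s in M. good (\<eta> s)"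
      unfolding good_def using cG by (simp add: AE_ball_countable)
    with eq show ?thesis
      by eventually_elim (simp add: \<Phi>_def)
  qed
  moreover have "\<Phi> (translate \<Gamma> J g h) = translate \<Gamma> I g (\<Phi> h)" if g: "g \<in> carrier \<Gamma>"
    and h: "h \<in> space (labellings J)" for g h
  proof -
    have good_step: "good (translate \<Gamma> J k u)" if "good u" "k \<in> carrier \<Gamma>" for u k
      using that by (simp add: good_def mJ mI)
    have one: "translate \<Gamma> J \<one>\<^bsub>\<Gamma>\<^esub> h = h"
    proof -
      have "h \<in> extensional J"
        using h by (auto simp: labellings_def space_PiM PiE_def)
      moreover have "act_element \<Gamma> \<one>\<^bsub>\<Gamma>\<^esub> i = i" if "i \<in> J" for i
      proof -
        have "e \<subseteq> carrier \<Gamma>" if "e \<in> cayley_edges \<Gamma> S" for e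
          using that S by (auto simp: cayley_edges_def)
        then have "act_vertex \<Gamma> \<one>\<^bsub>\<Gamma>\<^esub> ` e = e" if "e \<in> cayley_edges \<Gamma> S" for e
          using that by (force simp: act_vertex_def subset_iff image_iff)
        then show ?thesis
          using \<open>i \<in> J\<close> Jsub by (auto simp: sites_def bonds_def act_vertex_def)
      qed
      ultimately show ?thesis
        by (auto simp: translate_def fun_eq_iff extensional_def)
    qed
    have "good (translate \<Gamma> J g h) \<longleftrightarrow> good h"
      using good_step[of h g] good_step[of "translate \<Gamma> J g h" "inv\<^bsub>\<Gamma>\<^esub> g"] g one
      by (auto simp: mJ)
    moreover have "translate \<Gamma> I g (\<lambda>i\<in>I. False) = (\<lambda>i\<in>I. False)"
      using g Icl by (auto simp: translate_def fun_eq_iff)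
    ultimately show ?thesis
      using g by (auto simp: \<Phi>_def good_def)
  qed
  ultimately show ?thesis
    unfolding equivariant_representative_def by blast
qed

end

theory Submission
  imports Defs
begin

text \<open>Approximate the event that the identity has type \<open>A\<close>, up to probability \<open>4\<^sup>-\<^sup>n\<close>, by an event \<open>B\<^sub>n\<close>
  that depends on finitely many labels only. Run a random walk on the cluster of a vertex up to a
  geometric time with parameter \<open>l\<^sub>n\<close>, and let \<open>u\<^sub>n\<close> be the probability that \<open>B\<^sub>n\<close>, seen from the final
  position, fails. The transition kernel is symmetric, so by mass transport \<open>B\<^sub>n\<close> predicts the type wrongly
  at the final position with probability at most \<open>4\<^sup>-\<^sup>n\<close>, whatever \<open>l\<^sub>n\<close> is; hence \<open>u\<^sub>n\<close> tends to 0 if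
  the cluster has type \<open>A\<close> and to 1 otherwise. On an infinite cluster the walk spreads out as \<open>l\<^sub>n \<rightarrow> 0\<close>,
  so \<open>l\<^sub>n\<close> can be chosen after \<open>B\<^sub>n\<close> such that finitely many changed labels do not influence \<open>u\<^sub>n\<close> in
  the limit. By Harnack's inequality and the maximum principle, a finite change of the cluster changes
  the Green function by a factor that is bounded uniformly in \<open>l\<^sub>n\<close>; the geometric time is essential
  here, since the law of the walk at a fixed time has no such stability. So \<open>u\<^sub>n \<rightarrow> 0\<close> is a tail property.\<close>

section \<open>Resolvents of random walks\<close>

text \<open>A lazy walk: every neighbour gets weight \<open>1 / d\<close> with the same
  \<open>d\<close> at all vertices, and the remaining mass stays put. The kernel is therefore
  symmetric even where degrees vary.\<close>

definition walk :: "real \<Rightarrow> ('v \<Rightarrow> 'v set) \<Rightarrow> ('v \<Rightarrow> real) \<Rightarrow> 'v \<Rightarrow> real" where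
  "walk d N f x = f x + (\<Sum>y\<in>N x. f y - f x) / d"

text \<open>The expectation of \<open>f\<close> at an independent geometric time that equals
  \<open>k\<close> with probability \<open>l * (1 - l) ^ k\<close>.\<close>

definition resolvent :: "real \<Rightarrow> ('v \<Rightarrow> 'v set) \<Rightarrow> real \<Rightarrow> ('v \<Rightarrow> real) \<Rightarrow> 'v \<Rightarrow> real" where
  "resolvent d N l f x = (\<Sum>k. l * (1 - l) ^ k * (walk d N ^^ k) f x)"

text \<open>The probability that the walk started at the last, suppressed argument sits at
  \<open>v\<close> at the geometric time: \<open>l\<close> times the usual Green function of the
  walk killed at rate \<open>l\<close>.\<close>

definition green :: "real \<Rightarrow> ('v \<Rightarrow> 'v set) \<Rightarrow> real \<Rightarrow> 'v \<Rightarrow> 'v \<Rightarrow> real" where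
  "green d N l v = resolvent d N l (indicator {v})"

definition reach :: "('v \<Rightarrow> 'v set) \<Rightarrow> 'v \<Rightarrow> 'v \<Rightarrow> bool" where
  "reach N = (\<lambda>x y. y \<in> N x)\<^sup>*\<^sup>*"

locale bounded_graph =
  fixes N :: "'v \<Rightarrow> 'v set" and d :: real
  assumes finite_N: "finite (N x)"
    and card_N: "card (N x) \<le> d"
    and sym_N: "y \<in> N x \<Longrightarrow> x \<in> N y"
    and d_ge_1: "1 \<le> d"
begin

lemma d_pos: "0 < d"
  using d_ge_1 by simp

lemma walk_alt: "walk d N f x = (1 - card (N x) / d) * f x + (\<Sum>y\<in>N x. f y) / d"
  using d_pos by (simp add: walk_def sum_subtractf field_simps)

lemma walk_mono:
  assumes "\<And>y. y \<in> insert x (N x) \<Longrightarrow> f y \<le> g y"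
  shows "walk d N f x \<le> walk d N g x"
  unfolding walk_alt using card_N[of x] d_pos assms
  by (intro add_mono mult_left_mono divide_right_mono sum_mono) auto

lemma walk_cong:
  assumes "\<And>y. y \<in> insert x (N x) \<Longrightarrow> f y = g y"
  shows "walk d N f x = walk d N g x"
  using assms by (simp add: walk_def)

lemma walk_const [simp]: "walk d N (\<lambda>_. c) x = c"
  by (simp add: walk_def)

lemma walk_add: "walk d N (\<lambda>x. f x + g x) x = walk d N f x + walk d N g x"
  by (simp add: walk_alt sum.distrib algebra_simps add_divide_distrib)

lemma walk_cmult: "walk d N (\<lambda>x. c * f x) x = c * walk d N f x"
  by (simp add: walk_alt algebra_simps flip: sum_distrib_left)

lemma walkpow_mono:
  "(\<And>x. f x \<le> g x) \<Longrightarrow> (walk d N ^^ k) f x \<le> (walk d N ^^ k) g x"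
  by (induction k arbitrary: x) (simp_all add: walk_mono)

lemma walkpow_const [simp]: "(walk d N ^^ k) (\<lambda>_. c) x = c"
proof -
  have "walk d N (\<lambda>_. c) = (\<lambda>_. c)"
    by (rule ext) simp
  then have "(walk d N ^^ k) (\<lambda>_. c) = (\<lambda>_. c)"
    by (induction k) simp_all
  then show ?thesis
    by simp
qed

lemma walkpow_add: "(walk d N ^^ k) (\<lambda>x. f x + g x) x = (walk d N ^^ k) f x + (walk d N ^^ k) g x"
proof -
  have "(walk d N ^^ k) (\<lambda>x. f x + g x) = (\<lambda>x. (walk d N ^^ k) f x + (walk d N ^^ k) g x)"
    by (induction k) (simp_all add: walk_add)
  then show ?thesis
    by simp
qed

lemma walkpow_cmult: "(walk d N ^^ k) (\<lambda>x. c * f x) x = c * (walk d N ^^ k) f x"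
proof -
  have "(walk d N ^^ k) (\<lambda>x. c * f x) = (\<lambda>x. c * (walk d N ^^ k) f x)"
    by (induction k) (simp_all add: walk_cmult)
  then show ?thesis
    by simp
qed

lemma walkpow_nonneg: "(\<And>x. 0 \<le> f x) \<Longrightarrow> 0 \<le> (walk d N ^^ k) f x"
  using walkpow_mono[of "\<lambda>_. 0" f k x] by simp

lemma walkpow_bound:
  assumes "\<And>x. \<bar>f x\<bar> \<le> B"
  shows "\<bar>(walk d N ^^ k) f x\<bar> \<le> B"
proof -
  have "- B \<le> f x" "f x \<le> B" for x
    using assms[of x] by auto
  then show ?thesis
    using walkpow_mono[of "\<lambda>_. - B" f k x] walkpow_mono[of f "\<lambda>_. B" k x] by auto
qed

lemma walkpow_cong_closed:
  assumes "\<And>x. x \<in> D \<Longrightarrow> f x = g x" "\<And>x. x \<in> D \<Longrightarrow> N x \<subseteq> D" "x \<in> D"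
  shows "(walk d N ^^ k) f x = (walk d N ^^ k) g x"
  using assms(3)
proof (induction k arbitrary: x)
  case (Suc k)
  have "walk d N ((walk d N ^^ k) f) x = walk d N ((walk d N ^^ k) g) x"
    using assms(2)[OF Suc.prems] Suc by (intro walk_cong) auto
  then show ?case
    by simp
qed (simp add: assms)

text \<open>Each step looks at finitely many neighbours. This permits truncating a function to
  finite support before its resolvent is written as a finite sum of Green values.\<close>

lemma walkpow_finite_range:
  "\<exists>F. finite F \<and> (\<forall>f g. (\<forall>y\<in>F. f y = g y) \<longrightarrow> (walk d N ^^ k) f x = (walk d N ^^ k) g x)"
proof (induction k arbitrary: x)
  case 0
  then show ?case by (intro exI[of _ "{x}"]) simp
next
  case (Suc k)
  have "\<forall>x. \<exists>F. finite F \<and> (\<forall>f g. (\<forall>y\<in>F. f y = g y) \<longrightarrow> (walk d N ^^ k) f x = (walk d N ^^ k) g x)"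
    using Suc.IH by blast
  from choice[OF this] obtain F where F: "\<And>x. finite (F x)"
    "\<And>x f g. (\<forall>y\<in>F x. f y = g y) \<Longrightarrow> (walk d N ^^ k) f x = (walk d N ^^ k) g x"
    by blast
  show ?case
  proof (intro exI[of _ "\<Union>(F ` insert x (N x))"] conjI allI impI)
    show "finite (\<Union>(F ` insert x (N x)))"
      using F(1) finite_N by blast
    fix f g :: "'v \<Rightarrow> real"
    assume "\<forall>y\<in>\<Union>(F ` insert x (N x)). f y = g y"
    then have "(walk d N ^^ k) f z = (walk d N ^^ k) g z" if "z \<in> insert x (N x)" for z
      using that by (intro F(2)) blast
    then have "walk d N ((walk d N ^^ k) f) x = walk d N ((walk d N ^^ k) g) x"
      by (rule walk_cong)
    then show "(walk d N ^^ Suc k) f x = (walk d N ^^ Suc k) g x"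
      by simp
  qed
qed

text \<open>One step has a symmetric kernel. The induction peels the outermost step off at
  \<open>x\<close> and reinserts it as the innermost step, acting on the point mass at
  \<open>x\<close>.\<close>

lemma walkpow_sym: "(walk d N ^^ k) (indicator {y}) x = (walk d N ^^ k) (indicator {x}) y"
proof (induction k arbitrary: x y)
  case 0
  then show ?case by (auto simp: indicator_def)
next
  case (Suc k)
  let ?W = "walk d N ^^ k"
  \<comment> \<open>By symmetry of adjacency, one step applied to the point mass at \<open>x\<close>
    is a combination of point masses over \<open>N x\<close>; linearity of \<open>?W\<close> then
    matches it with the average around \<open>x\<close>.\<close>
  have [simp]: "walk d N (indicator {x}) = (\<lambda>z. indicator {x} z + (1/d) * (\<Sum>w\<in>N x. indicator {w} z + (-1) * indicator {x} z))"
  proof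
    fix z
    have N1: "(\<Sum>w\<in>N z. indicator {x} w) = (if x \<in> N z then 1 else (0::real))"
      using finite_N[of z] by (simp add: indicator_def)
    have N2: "(\<Sum>w\<in>N x. indicator {w} z) = (if z \<in> N x then 1 else (0::real))"
      using finite_N[of x] by (simp add: indicator_def eq_commute)
    show "walk d N (indicator {x}) z = indicator {x} z + (1/d) * (\<Sum>w\<in>N x. indicator {w} z + (-1) * indicator {x} z)"
    proof (cases "x = z")
      case True
      then show ?thesis
        using N1 N2 by (simp add: walk_def sum_subtractf)
    next
      case False
      then show ?thesis
        using N1 N2 sym_N[of x z] sym_N[of z x] by (auto simp: walk_def)
    qed
  qed
  have sumW: "?W (\<lambda>z. \<Sum>w\<in>F. f w z) y = (\<Sum>w\<in>F. ?W (f w) y)" for F :: "'v set" and f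
    by (induction F rule: infinite_finite_induct) (simp_all add: walkpow_add)
  have "(walk d N ^^ Suc k) (indicator {y}) x = ?W (indicator {x}) y + (1/d) * (\<Sum>w\<in>N x. ?W (indicator {w}) y - ?W (indicator {x}) y)"
    by (simp add: walk_def[of _ _ _ x] Suc)
  also have "\<dots> = ?W (\<lambda>z. indicator {x} z + (1/d) * (\<Sum>w\<in>N x. indicator {w} z + (-1) * indicator {x} z)) y"
    by (simp only: walkpow_add walkpow_cmult sumW) simp
  also have "\<dots> = ?W (walk d N (indicator {x})) y"
    by simp
  finally show ?case
    by (simp add: funpow_swap1)
qed

section \<open>Resolvents at a fixed parameter\<close>

context
  fixes l :: real
  assumes l: "0 < l" "l < 1"
begin

lemma weight_sums: "(\<lambda>k. l * (1 - l) ^ k) sums 1"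
  using geometric_sums[of "1 - l"] l by (auto dest: sums_mult[where c = l])

lemma summable_resolvent:
  assumes "\<And>x. \<bar>f x\<bar> \<le> B"
  shows "summable (\<lambda>k. l * (1 - l) ^ k * (walk d N ^^ k) f x)"
proof (rule summable_comparison_test')
  show "summable (\<lambda>k. l * (1 - l) ^ k * B)"
    using weight_sums by (intro summable_mult2) (auto simp: sums_iff)
  show "norm (l * (1 - l) ^ k * (walk d N ^^ k) f x) \<le> l * (1 - l) ^ k * B" if "0 \<le> k" for k
    using walkpow_bound[of f B k x, OF assms] l by (simp add: abs_mult mult_left_mono)
qed

lemma resolvent_sums:
  assumes "\<And>x. \<bar>f x\<bar> \<le> B"
  shows "(\<lambda>k. l * (1 - l) ^ k * (walk d N ^^ k) f x) sums resolvent d N l f x"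
  unfolding resolvent_def by (rule summable_sums[OF summable_resolvent[OF assms]])

lemma resolvent_mono:
  assumes "\<And>x. \<bar>f x\<bar> \<le> B" "\<And>x. \<bar>g x\<bar> \<le> B'" "\<And>x. f x \<le> g x"
  shows "resolvent d N l f x \<le> resolvent d N l g x"
  using l by (intro sums_le[OF _ resolvent_sums[OF assms(1)] resolvent_sums[OF assms(2)]] mult_left_mono walkpow_mono assms) auto

lemma resolvent_const: "resolvent d N l (\<lambda>_. c) x = c"
  using sums_unique2[OF resolvent_sums[of "\<lambda>_. c" "\<bar>c\<bar>" x]] sums_mult2[OF weight_sums, of c] by simp

lemma resolvent_add:
  assumes "\<And>x. \<bar>f x\<bar> \<le> B" "\<And>x. \<bar>g x\<bar> \<le> B'"
  shows "resolvent d N l (\<lambda>x. f x + g x) x = resolvent d N l f x + resolvent d N l g x"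
proof -
  have "\<bar>f x + g x\<bar> \<le> B + B'" for x
    using assms[of x] by linarith
  from sums_unique2[OF resolvent_sums[of "\<lambda>x. f x + g x" _ x, OF this]] sums_add[OF resolvent_sums[of f B x, OF assms(1)] resolvent_sums[of g B' x, OF assms(2)]]
  show ?thesis
    by (simp add: walkpow_add algebra_simps)
qed

lemma resolvent_cmult:
  assumes "\<And>x. \<bar>f x\<bar> \<le> B"
  shows "resolvent d N l (\<lambda>x. c * f x) x = c * resolvent d N l f x"
proof -
  have "\<bar>c * f x\<bar> \<le> \<bar>c\<bar> * B" for x
    using assms[of x] by (simp add: abs_mult mult_left_mono)
  from sums_unique2[OF resolvent_sums[of "\<lambda>x. c * f x" _ x, OF this]] sums_mult[OF resolvent_sums[of f B x, OF assms], of c]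
  show ?thesis
    by (simp add: walkpow_cmult mult_ac)
qed

lemma resolvent_nonneg:
  assumes "\<And>x. 0 \<le> f x" "\<And>x. f x \<le> B"
  shows "0 \<le> resolvent d N l f x"
  using resolvent_mono[of "\<lambda>_. 0" 0 f B x] assms by (simp add: resolvent_const)

lemma resolvent_le:
  assumes "\<And>x. 0 \<le> f x" "\<And>x. f x \<le> B"
  shows "resolvent d N l f x \<le> B"
proof -
  have "\<bar>f x\<bar> \<le> B" for x
    using assms[of x] by simp
  from resolvent_mono[of f B "\<lambda>_. B" "\<bar>B\<bar>" x, OF this] show ?thesis
    using assms by (simp add: resolvent_const)
qed

lemma resolvent_cong_closed:
  assumes "\<And>x. x \<in> D \<Longrightarrow> f x = g x" "\<And>x. x \<in> D \<Longrightarrow> N x \<subseteq> D" "x \<in> D"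
  shows "resolvent d N l f x = resolvent d N l g x"
  unfolding resolvent_def by (intro suminf_cong) (simp add: walkpow_cong_closed[OF assms])

text \<open>First-step analysis: with probability \<open>l\<close> the geometric time is 0;
  otherwise the walk makes one step and, by lack of memory, starts afresh.\<close>

lemma resolvent_eq:
  assumes f: "\<And>x. \<bar>f x\<bar> \<le> B"
  shows "resolvent d N l f x = l * f x + (1 - l) * walk d N (resolvent d N l f) x"
proof -
  let ?a = "\<lambda>k. l * (1 - l) ^ k"
  have "(\<lambda>k. ?a k * (walk d N ^^ k) f x + (\<Sum>y\<in>N x. ?a k * (walk d N ^^ k) f y - ?a k * (walk d N ^^ k) f x) / d)
      sums walk d N (resolvent d N l f) x"
    unfolding walk_def[of _ _ _ x]
    by (intro sums_add sums_divide sums_sum sums_diff resolvent_sums[OF f])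
  moreover have "?a k * (walk d N ^^ k) f x + (\<Sum>y\<in>N x. ?a k * (walk d N ^^ k) f y - ?a k * (walk d N ^^ k) f x) / d
      = ?a k * (walk d N ^^ Suc k) f x" for k
    by (simp add: walk_def[of _ _ _ x] distrib_left flip: sum_distrib_left right_diff_distrib)
  ultimately have "(\<lambda>k. (1 - l) * (?a k * (walk d N ^^ Suc k) f x)) sums ((1 - l) * walk d N (resolvent d N l f) x)"
    by (intro sums_mult) simp
  then have "(\<lambda>k. ?a (Suc k) * (walk d N ^^ Suc k) f x) sums ((1 - l) * walk d N (resolvent d N l f) x)"
    by (simp add: mult_ac)
  then have "(\<lambda>k. ?a k * (walk d N ^^ k) f x) sums ((1 - l) * walk d N (resolvent d N l f) x + l * f x)"
    by (subst (asm) sums_Suc_iff[where f = "\<lambda>k. ?a k * (walk d N ^^ k) f x"]) simp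
  with resolvent_sums[of f B x, OF f] show ?thesis
    using sums_unique2 by fastforce
qed

end

section \<open>Maximum principle, Green function and Harnack's inequality\<close>

lemma reach_sym: "reach N x y \<Longrightarrow> reach N y x"
  unfolding reach_def by (rule sympD[OF symp_rtranclp]) (auto intro: sympI sym_N)

text \<open>\<open>D\<close> may be infinite, so a maximum need not be attained. Instead the bound
  is iterated: where \<open>w\<close> is positive, averaging inside \<open>D\<close> improves it by
  the factor \<open>1 - l\<close>, so it tends to 0.\<close>

lemma max_principle:
  assumes l: "0 < l" "l < 1"
    and bound: "\<And>x. x \<in> D \<Longrightarrow> w x \<le> B"
    and sub: "\<And>x. x \<in> D \<Longrightarrow> w x \<le> 0 \<or> (N x \<subseteq> D \<and> w x \<le> (1 - l) * walk d N w x)"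
    and x: "x \<in> D"
  shows "w x \<le> 0"
proof -
  have le: "w y \<le> (1 - l) ^ k * \<bar>B\<bar>" if "y \<in> D" for k y
    using that
  proof (induction k arbitrary: y)
    case 0
    then show ?case using bound[of y] by simp
  next
    case (Suc k)
    show ?case
    proof (cases "w y \<le> 0")
      case True
      then show ?thesis
        using l by (intro order_trans[OF True] mult_nonneg_nonneg zero_le_power) auto
    next
      case False
      with sub[OF Suc.prems] have N: "N y \<subseteq> D" and w: "w y \<le> (1 - l) * walk d N w y"
        by auto
      have "walk d N w y \<le> walk d N (\<lambda>_. (1 - l) ^ k * \<bar>B\<bar>) y"
        using N Suc by (intro walk_mono) auto
      then have "(1 - l) * walk d N w y \<le> (1 - l) * ((1 - l) ^ k * \<bar>B\<bar>)"
        using l by (intro mult_left_mono) auto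
      with w show ?thesis by (simp add: mult_ac)
    qed
  qed
  have "(\<lambda>k. (1 - l) ^ k * \<bar>B\<bar>) \<longlonglongrightarrow> 0"
    using l by (intro tendsto_mult_left_zero LIMSEQ_realpow_zero) auto
  then show ?thesis
    by (rule LIMSEQ_le_const) (use le[OF x] in blast)
qed

lemma green_sym: "green d N l v y = green d N l y v"
  by (simp add: green_def resolvent_def walkpow_sym[of _ v y])

context
  fixes l :: real
  assumes l: "0 < l" "l < 1"
begin

lemma green_eq: "green d N l v x = l * indicator {v} x + (1 - l) * walk d N (green d N l v) x"
  unfolding green_def by (rule resolvent_eq[OF l, of _ 1]) (simp add: indicator_def)

lemma green_nonneg: "0 \<le> green d N l v x"
  unfolding green_def by (rule resolvent_nonneg[OF l, of _ 1]) (auto simp: indicator_def)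

lemma green_le_1: "green d N l v x \<le> 1"
  unfolding green_def by (rule resolvent_le[OF l]) (auto simp: indicator_def)

lemma green_diag_pos: "0 < green d N l v v"
proof -
  have "0 \<le> walk d N (green d N l v) v"
    using walk_mono[of v "\<lambda>_. 0" "green d N l v"] green_nonneg by simp
  then show ?thesis
    using l by (subst green_eq) (auto intro: add_pos_nonneg)
qed

text \<open>Off \<open>v\<close> the Green function is fixed by \<open>(1 - l) * walk\<close>, and
  subtracting a nonnegative constant leaves a subsolution, so the maximum principle applies to the
  difference from the diagonal value.\<close>

lemma green_le_diag: "green d N l v x \<le> green d N l v v"
proof -
  define w where "w = (\<lambda>x. green d N l v x + (-1) * green d N l v v)"
  have "w x \<le> 0"
  proof (rule max_principle[OF l, of UNIV w 1])
    show "w x \<le> 1" for x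
      using green_le_1[of v x] green_nonneg[of v v] by (simp add: w_def)
    show "w x \<le> 0 \<or> N x \<subseteq> UNIV \<and> w x \<le> (1 - l) * walk d N w x" for x
    proof (cases "x = v")
      case False
      have "walk d N w x = walk d N (green d N l v) x - green d N l v v"
        unfolding w_def by (subst walk_add) simp
      moreover have "green d N l v x = (1 - l) * walk d N (green d N l v) x"
        using green_eq[of v x] False by simp
      moreover have "0 \<le> l * green d N l v v"
        using l green_nonneg[of v v] by simp
      ultimately have "green d N l v x - green d N l v v \<le> (1 - l) * walk d N w x"
        by (simp only:) (simp add: algebra_simps)
      then show ?thesis
        by (simp add: w_def)
    qed (simp add: w_def)
  qed simp
  then show ?thesis
    by (simp add: w_def)
qed

lemma resolvent_finite_support:
  assumes "finite F" "\<And>x. \<bar>f x\<bar> \<le> B"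
  shows "resolvent d N l (\<lambda>x. if x \<in> F then f x else 0) v = (\<Sum>y\<in>F. f y * green d N l v y)"
  using assms(1)
proof induction
  case empty
  then show ?case by (simp add: resolvent_const[OF l])
next
  case (insert a F)
  have B: "0 \<le> B" using assms(2)[of a] by linarith
  have "(\<lambda>x. if x \<in> insert a F then f x else 0) = (\<lambda>x. (if x \<in> F then f x else 0) + f a * indicator {a} x)"
    using insert by (auto simp: indicator_def)
  then have "resolvent d N l (\<lambda>x. if x \<in> insert a F then f x else 0) v
      = resolvent d N l (\<lambda>x. if x \<in> F then f x else 0) v + resolvent d N l (\<lambda>x. f a * indicator {a} x) v"
    using assms(2) B by (simp only:) (rule resolvent_add[OF l, of _ B _ B], auto simp: indicator_def)
  also have "resolvent d N l (\<lambda>x. f a * indicator {a} x) v = f a * green d N l v a"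
    using green_sym[of l v a]
    by (subst resolvent_cmult[OF l, of _ 1]) (auto simp: indicator_def green_def)
  finally show ?case
    using insert by simp
qed

lemma resolvent_indicator_finite:
  assumes "finite F"
  shows "resolvent d N l (indicator F) v = (\<Sum>y\<in>F. green d N l v y)"
proof -
  have "(indicator F :: _ \<Rightarrow> real) = (\<lambda>x. if x \<in> F then 1 else 0)"
    by (auto simp: indicator_def)
  then show ?thesis
    using resolvent_finite_support[OF assms, of "\<lambda>_. 1" 1 v] by simp
qed

lemma sum_green_le_1:
  assumes "finite F"
  shows "(\<Sum>y\<in>F. green d N l v y) \<le> 1"
  unfolding resolvent_indicator_finite[OF assms, symmetric]
  by (rule resolvent_le[OF l]) (auto simp: indicator_def)

text \<open>The walk from \<open>v\<close> sees reachable vertices only, and sitting in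
  \<open>F\<close> costs at most \<open>card F\<close> times the largest Green value, which is the
  diagonal one.\<close>

lemma resolvent_perturb:
  assumes f: "\<And>x. 0 \<le> f x" "\<And>x. f x \<le> 1" and g: "\<And>x. 0 \<le> g x" "\<And>x. g x \<le> 1"
    and F: "finite F" and eq: "\<And>x. reach N v x \<Longrightarrow> x \<notin> F \<Longrightarrow> f x = g x"
  shows "resolvent d N l f v \<le> resolvent d N l g v + card F * green d N l v v"
proof -
  have 1: "\<bar>indicator {x. reach N v x} x * f x\<bar> \<le> 1" for x
    using f[of x] by (auto simp: indicator_def)
  have 2: "\<bar>g x + indicator F x\<bar> \<le> 2" for x
    using g[of x] by (auto simp: indicator_def)
  have "resolvent d N l f v = resolvent d N l (\<lambda>x. indicator {x. reach N v x} x * f x) v"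
    by (rule resolvent_cong_closed[of l "{x. reach N v x}", OF l]) (auto simp: reach_def intro: rtranclp.rtrancl_into_rtrancl)
  also have "\<dots> \<le> resolvent d N l (\<lambda>x. g x + indicator F x) v"
  proof (rule resolvent_mono[OF l 1 2])
    show "indicator {x. reach N v x} x * f x \<le> g x + indicator F x" for x
      using eq[of x] f[of x] g[of x] by (auto simp: indicator_def)
  qed
  also have "\<dots> = resolvent d N l g v + (\<Sum>y\<in>F. green d N l v y)"
    using g by (subst resolvent_add[OF l, of _ 1 _ 1])
      (auto simp: resolvent_indicator_finite[OF F] indicator_def)
  also have "(\<Sum>y\<in>F. green d N l v y) \<le> card F * green d N l v v"
    using sum_bounded_above[of F "green d N l v"] green_le_diag by simp
  finally show ?thesis by simp
qed

text \<open>From \<open>y\<close> the walk survives its first step with probability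
  \<open>1 - l\<close> and then moves to \<open>x\<close> with probability at least
  \<open>1 / d\<close>.\<close>

lemma resolvent_neighbour_le:
  assumes f: "\<And>x. 0 \<le> f x" "\<And>x. f x \<le> 1" and y: "y \<in> N x"
  shows "(1 - l) / d * resolvent d N l f x \<le> resolvent d N l f y"
proof -
  let ?u = "resolvent d N l f"
  have u: "0 \<le> ?u z" for z
    by (rule resolvent_nonneg[OF l f])
  have "?u x \<le> (\<Sum>z\<in>N y. ?u z)"
    using sym_N[OF y] finite_N u by (intro member_le_sum) auto
  then have "?u x / d \<le> (\<Sum>z\<in>N y. ?u z) / d"
    using d_pos by (intro divide_right_mono) auto
  also have "\<dots> \<le> walk d N ?u y"
    using card_N[of y] d_pos u[of y] unfolding walk_alt by simp
  finally have "(1 - l) * (?u x / d) \<le> (1 - l) * walk d N ?u y"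
    using l by (intro mult_left_mono) auto
  also have "\<dots> \<le> ?u y"
    using resolvent_eq[OF l, of f 1 y] f l by (simp add: abs_of_nonneg)
  finally show ?thesis by simp
qed

text \<open>If the value at \<open>z\<close> is within order \<open>l\<close> of the maximum, no
  neighbour can lie much lower, since the others cannot compensate in the nearly harmonic average.
  In the constant, \<open>d\<close> clears the denominator, and \<open>d * \<bar>c\<bar>\<close>
  bounds what the other neighbours gain over \<open>z\<close>.\<close>

lemma green_neighbour_ge:
  assumes "y \<in> N z" and c: "green d N l v v - c * l \<le> green d N l v z"
  shows "green d N l v v - (c + d + d * \<bar>c\<bar>) * l \<le> green d N l v y"
proof -
  let ?g = "green d N l v"
  have w0: "0 \<le> walk d N ?g z"
    using walk_mono[of z "\<lambda>_. 0" ?g] green_nonneg by simp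
  have "?g z \<le> l + (1 - l) * walk d N ?g z"
    using l by (subst green_eq) (auto simp: indicator_def)
  also have "\<dots> \<le> l + walk d N ?g z"
    using w0 l by (simp add: algebra_simps)
  finally have "- l \<le> (\<Sum>w\<in>N z. ?g w - ?g z) / d"
    by (simp add: walk_def)
  then have "- (d * l) \<le> (\<Sum>w\<in>N z. ?g w - ?g z)"
    using d_pos by (simp add: field_simps)
  also have "\<dots> = (?g y - ?g z) + (\<Sum>w\<in>N z - {y}. ?g w - ?g z)"
    using assms(1) finite_N by (simp add: sum.remove)
  also have "(\<Sum>w\<in>N z - {y}. ?g w - ?g z) \<le> of_nat (card (N z - {y})) * (\<bar>c\<bar> * l)"
  proof (rule sum_bounded_above)
    fix w
    have "c * l \<le> \<bar>c\<bar> * l"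
      using l by (intro mult_right_mono) auto
    with green_le_diag[of v w] c show "?g w - ?g z \<le> \<bar>c\<bar> * l"
      by linarith
  qed
  also have "\<dots> \<le> d * (\<bar>c\<bar> * l)"
    using card_N[of z] card_mono[OF finite_N, of "N z - {y}" z] l
    by (intro mult_right_mono) auto
  finally show ?thesis
    using c by (simp add: algebra_simps)
qed

end

text \<open>The neighbour estimate is chained along a path from \<open>x\<close> to
  \<open>y\<close>. For \<open>l <= 1/2\<close> each edge costs a factor of at least
  \<open>1 / (2 * d)\<close>, so the constant depends on neither \<open>l\<close> nor
  \<open>f\<close>.\<close>

lemma harnack:
  assumes "reach N x y"
  shows "\<exists>c>0. \<forall>l f. 0 < l \<longrightarrow> l \<le> 1/2 \<longrightarrow> (\<forall>z. 0 \<le> f z \<and> f z \<le> 1) \<longrightarrow>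
    c * resolvent d N l f x \<le> resolvent d N l f y"
  using assms unfolding reach_def
proof (induction rule: rtranclp_induct)
  case base
  show ?case by (intro exI[of _ 1]) auto
next
  case (step y z)
  then obtain c where c: "c > 0" "\<And>l f. 0 < l \<Longrightarrow> l \<le> 1/2 \<Longrightarrow> (\<forall>z. 0 \<le> f z \<and> f z \<le> 1) \<Longrightarrow>
    c * resolvent d N l f x \<le> resolvent d N l f y"
    by blast
  show ?case
  proof (intro exI[of _ "c / (2 * d)"] conjI allI impI)
    show "0 < c / (2 * d)"
      using c d_pos by simp
    fix l :: real and f :: "'v \<Rightarrow> real"
    assume l: "0 < l" "l \<le> 1/2" and f: "\<forall>z. 0 \<le> f z \<and> f z \<le> 1"
    have u: "0 \<le> resolvent d N l f y"
      using l f by (intro resolvent_nonneg[of l f 1]) auto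
    have "c / (2 * d) * resolvent d N l f x = 1 / (2 * d) * (c * resolvent d N l f x)"
      by simp
    also have "\<dots> \<le> 1 / (2 * d) * resolvent d N l f y"
      using c(2)[OF l f] d_pos by (intro mult_left_mono) auto
    also have "\<dots> \<le> (1 - l) / d * resolvent d N l f y"
      using l u d_pos by (intro mult_right_mono) (auto simp: field_simps)
    also have "\<dots> \<le> resolvent d N l f z"
      using l f step by (intro resolvent_neighbour_le) auto
    finally show "c / (2 * d) * resolvent d N l f x \<le> resolvent d N l f z" .
  qed
qed

lemma green_reach_ge:
  assumes "reach N v z"
  shows "\<exists>c. \<forall>l. 0 < l \<longrightarrow> l < 1 \<longrightarrow> green d N l v v - c * l \<le> green d N l v z"
  using assms unfolding reach_def
proof (induction rule: rtranclp_induct)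
  case base
  show ?case by (intro exI[of _ 0]) auto
next
  case (step y z)
  then show ?case
    using green_neighbour_ge by blast
qed

text \<open>For small \<open>l\<close> the Green function is nearly constant on any finite set of
  reachable vertices. Its total mass is at most 1, so many such vertices force the common value to
  be small.\<close>

lemma green_diag_tendsto_0:
  assumes inf: "infinite {y. reach N v y}"
  shows "(\<lambda>m. green d N (1 / (real m + 2)) v v) \<longlonglongrightarrow> 0"
proof (rule LIMSEQ_I)
  fix e :: real
  assume e: "0 < e"
  \<comment> \<open>For small \<open>l\<close>, \<open>bound\<close> below gives a diagonal value
    less than \<open>2 / k\<close>, hence a \<open>k\<close> above \<open>2 / e\<close>.\<close>
  define k where "k = nat \<lceil>2 / e\<rceil> + 1"
  have k: "2 / e < k" "0 < k"
    unfolding k_def by linarith+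
  obtain F where F: "F \<subseteq> {y. reach N v y}" "card F = k" "finite F"
    using infinite_arbitrarily_large[OF inf] by metis
  have "\<forall>z\<in>F. \<exists>c. \<forall>l. 0 < l \<longrightarrow> l < 1 \<longrightarrow> green d N l v v - c * l \<le> green d N l v z"
    using F(1) green_reach_ge by blast
  from bchoice[OF this] obtain c where c: "\<And>z l. z \<in> F \<Longrightarrow> 0 < l \<Longrightarrow> l < 1 \<Longrightarrow> green d N l v v - c z * l \<le> green d N l v z"
    by blast
  define s where "s = \<bar>\<Sum>z\<in>F. c z\<bar> + 1"
  have s: "0 < s" by (simp add: s_def)
  have bound: "green d N l v v * k \<le> 1 + s * l" if "0 < l" "l < 1" for l
  proof -
    have "(\<Sum>z\<in>F. green d N l v v - c z * l) \<le> (\<Sum>z\<in>F. green d N l v z)"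
      using c that by (intro sum_mono) auto
    also have "\<dots> \<le> 1"
      by (rule sum_green_le_1[OF that F(3)])
    finally have "k * green d N l v v - (\<Sum>z\<in>F. c z) * l \<le> 1"
      by (simp add: sum_subtractf F(2) flip: sum_distrib_right)
    moreover have "(\<Sum>z\<in>F. c z) * l \<le> s * l"
      using that unfolding s_def by (intro mult_right_mono) auto
    ultimately show ?thesis
      by (simp add: mult_ac)
  qed
  show "\<exists>no. \<forall>m\<ge>no. norm (green d N (1 / (real m + 2)) v v - 0) < e"
  proof (intro exI[of _ "nat \<lceil>s\<rceil>"] allI impI)
    fix m assume "nat \<lceil>s\<rceil> \<le> m"
    then have m: "s \<le> m" by linarith
    let ?l = "1 / (real m + 2)"
    have l: "0 < ?l" "?l < 1" by auto
    have "s * ?l < 1"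
      using m by (simp add: field_simps)
    with bound[OF l] have "green d N ?l v v * k < 2"
      by linarith
    also have "2 < e * k"
      using k e by (simp add: field_simps)
    finally have "green d N ?l v v < e"
      using k by simp
    then show "norm (green d N ?l v v - 0) < e"
      using green_nonneg[OF l, of v v] by simp
  qed
qed

end

section \<open>Comparison of two graphs\<close>

text \<open>A partial sum of the left resolvent depends on finitely many values of \<open>f\<close>.
  After truncation to these, both resolvents are finite combinations of Green values and can be
  compared term by term.\<close>

lemma resolvent_le_of_green_le:
  assumes "bounded_graph N d" "bounded_graph N' d" and l: "0 < l" "l < 1"
    and C: "0 \<le> C" "\<And>y. y \<in> D \<Longrightarrow> green d N l v y \<le> C * green d N' l v y"
    and f: "\<And>x. 0 \<le> f x" "\<And>x. f x \<le> 1" "\<And>x. x \<notin> D \<Longrightarrow> f x = 0"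
  shows "resolvent d N l f v \<le> C * resolvent d N' l f v"
proof -
  interpret G: bounded_graph N d by fact
  interpret H: bounded_graph N' d by fact
  have B: "\<bar>f x\<bar> \<le> 1" for x
    using f(1,2)[of x] by simp
  have "(\<Sum>k<n. l * (1 - l) ^ k * (walk d N ^^ k) f v) \<le> C * resolvent d N' l f v" for n
  proof -
    have "\<forall>k. \<exists>F. finite F \<and> (\<forall>f g. (\<forall>y\<in>F. f y = g y) \<longrightarrow> (walk d N ^^ k) f v = (walk d N ^^ k) g v)"
      using G.walkpow_finite_range by blast
    from choice[OF this] obtain F where F: "\<And>k. finite (F k)"
      "\<And>k f g. (\<forall>y\<in>F k. f y = g y) \<Longrightarrow> (walk d N ^^ k) f v = (walk d N ^^ k) g v"
      by blast
    define E where "E = (\<Union>k<n. F k)"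
    define g where "g x = (if x \<in> E then f x else 0)" for x
    have E: "finite E" by (simp add: E_def F(1))
    have g: "0 \<le> g x" "\<bar>g x\<bar> \<le> 1" "g x \<le> f x" for x
      using f(1,2)[of x] by (auto simp: g_def)
    have "(\<Sum>k<n. l * (1 - l) ^ k * (walk d N ^^ k) f v) = (\<Sum>k<n. l * (1 - l) ^ k * (walk d N ^^ k) g v)"
      by (intro sum.cong refl arg_cong2[where f = times] F(2)) (auto simp: g_def E_def)
    also have "\<dots> \<le> resolvent d N l g v"
      unfolding resolvent_def using l g
      by (intro sum_le_suminf G.summable_resolvent[OF l, of g 1])
        (auto intro!: mult_nonneg_nonneg G.walkpow_nonneg)
    also have "\<dots> = (\<Sum>y\<in>E. f y * green d N l v y)"
      unfolding g_def by (rule G.resolvent_finite_support[OF l E B])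
    also have "\<dots> \<le> (\<Sum>y\<in>E. f y * (C * green d N' l v y))"
    proof (rule sum_mono)
      show "f y * green d N l v y \<le> f y * (C * green d N' l v y)" for y
        using C(2)[of y] f[of y] by (cases "y \<in> D") (auto intro: mult_left_mono)
    qed
    also have "\<dots> = C * (\<Sum>y\<in>E. f y * green d N' l v y)"
      by (simp add: sum_distrib_left mult_ac)
    also have "\<dots> = C * resolvent d N' l g v"
      unfolding g_def by (subst H.resolvent_finite_support[OF l E B]) simp
    also have "\<dots> \<le> C * resolvent d N' l f v"
      using C(1) g B by (intro mult_left_mono H.resolvent_mono[OF l, of g 1 f 1])
    finally show ?thesis .
  qed
  then show ?thesis
    unfolding resolvent_def[of d N]
    by (intro suminf_le_const G.summable_resolvent[OF l, of f 1] B) blast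
qed

text \<open>\<open>D\<close> models the intersection of two clusters, and the finite set
  \<open>Q\<close> holds the base point and all places where the graphs differ. \<open>D\<close>
  need not be connected in itself: its vertices only have to be reachable in each whole
  graph.\<close>

locale graph_pair = G: bounded_graph N d + H: bounded_graph N' d
  for N N' :: "'v \<Rightarrow> 'v set" and d :: real +
  fixes D Q :: "'v set" and v :: 'v
  assumes finite_Q: "finite Q"
    and v: "v \<in> D" "v \<in> Q"
    and agree: "\<And>x. x \<in> D \<Longrightarrow> x \<notin> Q \<Longrightarrow> N x = N' x \<and> N x \<subseteq> D"
    and connected: "\<And>x. x \<in> D \<Longrightarrow> reach N v x" "\<And>x. x \<in> D \<Longrightarrow> reach N' v x"
    and cover: "\<And>x. reach N v x \<Longrightarrow> x \<in> D \<union> Q" "\<And>x. reach N' v x \<Longrightarrow> x \<in> D \<union> Q"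
begin

text \<open>Both Green functions satisfy the same equation on \<^term>\<open>D - Q\<close>, and on the finite set
  \<^term>\<open>D \<inter> Q\<close> they are comparable by Harnack's inequality with constants independent of \<open>l\<close>.\<close>

lemma green_compare:
  "\<exists>K>0. \<forall>l. 0 < l \<longrightarrow> l \<le> 1/2 \<longrightarrow> (\<forall>y\<in>D.
     green d N l v y * green d N' l v v \<le> K * green d N' l v y * green d N l v v)"
proof -
  have "\<forall>q\<in>D \<inter> Q. \<exists>c>0. \<forall>l. 0 < l \<longrightarrow> l \<le> 1/2 \<longrightarrow> c * green d N' l v v \<le> green d N' l v q"
  proof
    fix q assume "q \<in> D \<inter> Q"
    then have "reach N' v q" using connected by blast
    from H.harnack[OF this] obtain c where c: "c > 0"
      "\<And>l f. 0 < l \<Longrightarrow> l \<le> 1/2 \<Longrightarrow> (\<forall>z. 0 \<le> f z \<and> f z \<le> 1) \<Longrightarrow>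
        c * resolvent d N' l f v \<le> resolvent d N' l f q"
      by blast
    have "c * green d N' l v v \<le> green d N' l v q" if "0 < l" "l \<le> 1/2" for l
      unfolding green_def by (rule c(2)[OF that]) (auto simp: indicator_def)
    with c(1) show "\<exists>c>0. \<forall>l. 0 < l \<longrightarrow> l \<le> 1/2 \<longrightarrow> c * green d N' l v v \<le> green d N' l v q"
      by blast
  qed
  from bchoice[OF this] obtain c where c: "\<And>q. q \<in> D \<inter> Q \<Longrightarrow> c q > 0"
    "\<And>q l. q \<in> D \<inter> Q \<Longrightarrow> 0 < l \<Longrightarrow> l \<le> 1/2 \<Longrightarrow> c q * green d N' l v v \<le> green d N' l v q"
    by blast
  \<comment> \<open>A single Harnack constant for the finite set \<open>D \<inter> Q\<close>, which
    is nonempty because it contains \<open>v\<close>.\<close>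
  define b where "b = Min (c ` (D \<inter> Q))"
  have fin: "finite (c ` (D \<inter> Q))" "c ` (D \<inter> Q) \<noteq> {}"
    using finite_Q v by auto
  have b: "b > 0" "\<And>q. q \<in> D \<inter> Q \<Longrightarrow> b \<le> c q"
    unfolding b_def using c(1) fin by auto
  show ?thesis
  proof (intro exI[of _ "1 / b"] conjI allI impI ballI)
    show "0 < 1 / b" using b by simp
    fix l :: real and y
    assume l: "0 < l" "l \<le> 1/2" and y: "y \<in> D"
    then have l': "0 < l" "l < 1" by auto
    let ?g = "green d N l v" and ?h = "green d N' l v"
    \<comment> \<open>The claim with denominators cleared. Harnack and the maximality of the
      diagonal give \<open>w <= 0\<close> on \<open>D \<inter> Q\<close>; on the rest of
      \<open>D\<close> the function \<open>w\<close> solves the common killed equation.\<close>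
    define w where "w x = ?h v * ?g x + (- (1 / b) * ?g v) * ?h x" for x
    have "w y \<le> 0"
    proof (rule G.max_principle[OF l', of D w 1])
      show "w x \<le> 1" for x
      proof -
        have "?h v * ?g x \<le> 1"
          using G.green_le_1[OF l', of v x] H.green_le_1[OF l', of v v]
            G.green_nonneg[OF l', of v x] H.green_nonneg[OF l', of v v]
          by (intro mult_le_one) auto
        moreover have "0 \<le> (1 / b) * ?g v * ?h x"
          using b G.green_nonneg[OF l', of v v] H.green_nonneg[OF l', of v x] by simp
        ultimately show ?thesis by (simp add: w_def)
      qed
      fix x assume x: "x \<in> D"
      show "w x \<le> 0 \<or> N x \<subseteq> D \<and> w x \<le> (1 - l) * walk d N w x"
      proof (cases "x \<in> Q")
        case True
        with x have q: "x \<in> D \<inter> Q" by simp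
        have "?g v * (b * ?h v) \<le> ?g v * ?h x"
          using b(2)[OF q] c(2)[OF q l] G.green_nonneg[OF l', of v v] H.green_nonneg[OF l', of v v]
          by (intro mult_left_mono) (auto intro: order_trans[OF mult_right_mono])
        then have "?g v * ?h v \<le> (1 / b) * (?g v * ?h x)"
          using b(1) by (simp add: field_simps)
        moreover have "?h v * ?g x \<le> ?h v * ?g v"
          using G.green_le_diag[OF l', of v x] H.green_nonneg[OF l', of v v]
          by (intro mult_left_mono)
        ultimately have "w x \<le> 0"
          by (simp add: w_def mult_ac)
        then show ?thesis by blast
      next
        case False
        have eq: "N x = N' x" "N x \<subseteq> D"
          using agree[OF x False] by auto
        \<comment> \<open>The source term of the Green equation sits at \<open>v\<close>, which lies
          in \<open>Q\<close>, so it is absent here.\<close>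
        have "x \<noteq> v" using False v by blast
        then have "?g x = (1 - l) * walk d N ?g x" "?h x = (1 - l) * walk d N ?h x"
          using G.green_eq[OF l', of v x] H.green_eq[OF l', of v x] eq(1) by (auto simp: walk_def)
        then have "w x = ?h v * ((1 - l) * walk d N ?g x) + (- (1 / b) * ?g v) * ((1 - l) * walk d N ?h x)"
          by (simp add: w_def)
        also have "\<dots> = (1 - l) * walk d N w x"
          unfolding w_def G.walk_add G.walk_cmult by (simp only: distrib_left mult_ac)
        finally show ?thesis
          using eq(2) by simp
      qed
    qed (rule y)
    then show "?g y * ?h v \<le> 1 / b * ?h y * ?g v"
      by (simp add: w_def mult_ac)
  qed
qed

lemma swap: "graph_pair N' N d D Q v"
proof
  show "N' x = N x \<and> N' x \<subseteq> D" if "x \<in> D" "x \<notin> Q" for x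
    using agree[OF that] by auto
qed (use finite_Q v connected cover in auto)

text \<open>\<open>green_compare\<close> controls only the ratios of Green values to the diagonal.
  Total mass supplies the rest: the walk on \<open>N\<close> ends in \<open>D\<close> with
  probability at least 1/2 once \<open>Q\<close> is unlikely, while on \<open>N'\<close> that
  probability is at most 1. This bounds the new diagonal by the old one.\<close>

lemma resolvent_compare:
  "\<exists>K>0. \<forall>l. 0 < l \<longrightarrow> l \<le> 1/2 \<longrightarrow> card Q * green d N l v v \<le> 1/2 \<longrightarrow>
     green d N' l v v \<le> K * green d N l v v \<and>
     (\<forall>f f' Z. (\<forall>x. 0 \<le> f x \<and> f x \<le> 1) \<longrightarrow> (\<forall>x. 0 \<le> f' x \<and> f' x \<le> 1) \<longrightarrow> finite Z \<longrightarrow>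
        (\<forall>y\<in>D - Z. f y = f' y) \<longrightarrow>
        resolvent d N' l f' v \<le> K * (resolvent d N l f v + (card Z + card Q) * green d N l v v))"
proof -
  interpret S: graph_pair N' N d D Q v
    by (rule swap)
  obtain K0 where K0: "K0 > 0" "\<And>l y. 0 < l \<Longrightarrow> l \<le> 1/2 \<Longrightarrow> y \<in> D \<Longrightarrow>
     green d N l v y * green d N' l v v \<le> K0 * green d N' l v y * green d N l v v"
    using green_compare by blast
  obtain K1 where K1: "K1 > 0" "\<And>l y. 0 < l \<Longrightarrow> l \<le> 1/2 \<Longrightarrow> y \<in> D \<Longrightarrow>
     green d N' l v y * green d N l v v \<le> K1 * green d N l v y * green d N' l v v"
    using S.green_compare by blast
  \<comment> \<open>Large enough for \<open>2 * K0\<close>, the diagonal bound, and for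
    \<open>2 * K0 * K1\<close>, the pointwise bound after the new diagonal value has been replaced
    by the old one.\<close>
  define K where "K = 2 * K0 * (K1 + 1)"
  have K: "2 * K0 * K1 \<le> K" "2 * K0 \<le> K" "0 < K"
    using K0(1) K1(1) by (auto simp: K_def algebra_simps add_pos_pos)
  have bound: "green d N' l v v \<le> 2 * K0 * green d N l v v"
    if l: "0 < l" "l \<le> 1/2" and small: "card Q * green d N l v v \<le> 1/2" for l
  proof -
    have l': "0 < l" "l < 1" using l by auto
    let ?g = "green d N l v v" and ?h = "green d N' l v v"
    have pos: "0 < ?g" "0 < ?h"
      using G.green_diag_pos[OF l'] H.green_diag_pos[OF l'] by auto
    have "1 \<le> resolvent d N l (indicator D) v + card Q * ?g"
      using G.resolvent_perturb[OF l', of "\<lambda>_. 1" "indicator D" Q v] cover(1) finite_Q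
      by (auto simp: G.resolvent_const[OF l'] indicator_def)
    also have "resolvent d N l (indicator D) v \<le> (K0 * ?g / ?h) * resolvent d N' l (indicator D) v"
    proof (rule resolvent_le_of_green_le[OF G.bounded_graph_axioms H.bounded_graph_axioms l', of _ D])
      show "green d N l v y \<le> (K0 * ?g / ?h) * green d N' l v y" if "y \<in> D" for y
        using K0(2)[OF l that] pos by (simp add: field_simps)
    qed (use K0 pos in \<open>auto simp: indicator_def\<close>)
    also have "\<dots> \<le> (K0 * ?g / ?h) * 1"
      using K0 pos by (intro mult_left_mono H.resolvent_le[OF l']) (auto simp: indicator_def)
    finally have "1 - card Q * ?g \<le> K0 * ?g / ?h"
      by simp
    then have "1/2 \<le> K0 * ?g / ?h"
      using small by linarith
    then show ?thesis
      using pos by (simp add: field_simps)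
  qed
  show ?thesis
  proof (intro exI[of _ K] conjI allI impI)
    fix l :: real
    assume l: "0 < l" "l \<le> 1/2" and small: "card Q * green d N l v v \<le> 1/2"
    have l': "0 < l" "l < 1" using l by auto
    let ?g = "green d N l v v" and ?h = "green d N' l v v"
    have pos: "0 < ?g" "0 < ?h"
      using G.green_diag_pos[OF l'] H.green_diag_pos[OF l'] by auto
    have hg: "?h \<le> 2 * K0 * ?g"
      by (rule bound[OF l small])
    also have hK: "\<dots> \<le> K * ?g"
      using K(2) pos by (intro mult_right_mono) auto
    finally show "?h \<le> K * ?g" .
    fix f f' :: "'v \<Rightarrow> real" and Z :: "'v set"
    assume f: "\<forall>x. 0 \<le> f x \<and> f x \<le> 1" and f': "\<forall>x. 0 \<le> f' x \<and> f' x \<le> 1" and Z: "finite Z"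
      and eq: "\<forall>y\<in>D - Z. f y = f' y"
    \<comment> \<open>Comparison of Green functions is available on \<open>D\<close> only. Reachable
      vertices outside \<open>D\<close> lie in \<open>Q\<close>, and their contribution is charged
      to \<open>Z \<union> Q\<close>.\<close>
    let ?f = "\<lambda>x. if x \<in> D then f x else 0"
    have f1: "0 \<le> ?f x" "?f x \<le> 1" for x
      using f by auto
    have "resolvent d N' l f' v \<le> resolvent d N' l ?f v + card (Z \<union> Q) * ?h"
      using f f' eq cover(2) Z finite_Q by (intro H.resolvent_perturb[OF l']) auto
    also have "card (Z \<union> Q) * ?h \<le> (card Z + card Q) * (K * ?g)"
      using \<open>?h \<le> K * ?g\<close> pos card_Un_le[of Z Q] by (intro mult_mono) auto
    also have "resolvent d N' l ?f v \<le> (2 * K0 * K1) * resolvent d N l ?f v"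
    proof (rule resolvent_le_of_green_le[OF H.bounded_graph_axioms G.bounded_graph_axioms l', of _ D])
      show "green d N' l v y \<le> (2 * K0 * K1) * green d N l v y" if "y \<in> D" for y
      proof -
        have "green d N' l v y * ?g \<le> K1 * green d N l v y * ?h"
          by (rule K1(2)[OF l that])
        also have "\<dots> \<le> K1 * green d N l v y * (2 * K0 * ?g)"
          using hg K1(1) G.green_nonneg[OF l', of v y] by (intro mult_left_mono) auto
        finally show ?thesis
          using pos by (simp add: mult_ac)
      qed
    qed (use K0 K1 f in auto)
    also have "(2 * K0 * K1) * resolvent d N l ?f v \<le> K * resolvent d N l ?f v"
      using K G.resolvent_nonneg[OF l' f1] by (intro mult_right_mono) auto
    also have "K * resolvent d N l ?f v \<le> K * resolvent d N l f v"
      using K f by (intro mult_left_mono G.resolvent_mono[OF l', of _ 1 _ 1]) auto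
    finally show "resolvent d N' l f' v \<le> K * (resolvent d N l f v + (card Z + card Q) * ?g)"
      by (simp add: algebra_simps)
  qed (rule K(3))
qed

end

text \<open>The factor \<open>j n\<close> bounds, up to a constant, the number of vertices at which \<open>f n\<close> is affected by a
  finite change of the labelling.\<close>

definition vanishing :: "real \<Rightarrow> ('v \<Rightarrow> 'v set) \<Rightarrow> (nat \<Rightarrow> real) \<Rightarrow> (nat \<Rightarrow> real) \<Rightarrow> (nat \<Rightarrow> 'v \<Rightarrow> real) \<Rightarrow> 'v \<Rightarrow> bool" where
  "vanishing d N l j f v \<longleftrightarrow>
     (\<lambda>n. j n * green d N (l n) v v) \<longlonglongrightarrow> 0 \<and> (\<lambda>n. resolvent d N (l n) (f n) v) \<longlonglongrightarrow> 0"

text \<open>Harnack moves both limits. For the Green part it is applied to the point mass at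
  \<open>w\<close>; symmetry and maximality of the diagonal at \<open>v\<close> then give a bound by
  the diagonal value at \<open>v\<close>.\<close>

lemma (in bounded_graph) vanishing_reach:
  fixes j :: "nat \<Rightarrow> real"
  assumes l: "\<And>n. 0 < l n" "\<And>n. l n \<le> 1/2" and j: "\<And>n. 1 \<le> j n"
    and f: "\<And>n x. 0 \<le> f n x \<and> f n x \<le> 1"
    and r: "reach N v w" and van: "vanishing d N l j f v"
  shows "vanishing d N l j f w"
proof -
  have l1: "l n < 1" for n
    using l(2)[of n] by simp
  from harnack[OF reach_sym[OF r]] obtain c where c: "c > 0"
    "\<And>l f. 0 < l \<Longrightarrow> l \<le> 1/2 \<Longrightarrow> (\<forall>z. 0 \<le> f z \<and> f z \<le> 1) \<Longrightarrow>
        c * resolvent d N l f w \<le> resolvent d N l f v"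
    by blast
  have U: "resolvent d N (l n) (f n) w \<le> resolvent d N (l n) (f n) v / c" for n
    using c(2)[of "l n" "f n"] l f c(1) by (simp add: field_simps)
  have g: "green d N (l n) w w \<le> green d N (l n) v v / c" for n
  proof -
    have "c * resolvent d N (l n) (indicator {w}) w \<le> resolvent d N (l n) (indicator {w}) v"
      by (rule c(2)) (use l in \<open>auto simp: indicator_def\<close>)
    then have "c * green d N (l n) w w \<le> green d N (l n) w v"
      by (simp add: green_def)
    also have "\<dots> = green d N (l n) v w"
      by (rule green_sym)
    also have "\<dots> \<le> green d N (l n) v v"
      using l(1) l1 by (rule green_le_diag)
    finally show ?thesis
      using c(1) by (simp add: field_simps)
  qed
  have lim: "(\<lambda>n. j n * green d N (l n) v v / c) \<longlonglongrightarrow> 0" "(\<lambda>n. resolvent d N (l n) (f n) v / c) \<longlonglongrightarrow> 0"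
    using van by (auto simp: vanishing_def intro!: tendsto_divide_zero)
  have "0 \<le> j n * green d N (l n) w w" for n
    using j[of n] green_nonneg[of "l n" w w] l l1 by (intro mult_nonneg_nonneg) auto
  moreover have "j n * green d N (l n) w w \<le> j n * green d N (l n) v v / c" for n
    using mult_left_mono[OF g[of n], of "j n"] j[of n] by simp
  ultimately have "(\<lambda>n. j n * green d N (l n) w w) \<longlonglongrightarrow> 0"
    by (intro tendsto_sandwich[OF always_eventually always_eventually tendsto_const lim(1)] allI)
  moreover have "0 \<le> resolvent d N (l n) (f n) w" for n
    using l l1 f by (intro resolvent_nonneg[of _ _ 1]) auto
  then have "(\<lambda>n. resolvent d N (l n) (f n) w) \<longlonglongrightarrow> 0"
    using U by (intro tendsto_sandwich[OF always_eventually always_eventually tendsto_const lim(2)] allI)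
  ultimately show ?thesis
    by (simp add: vanishing_def)
qed

text \<open>The sets \<open>Z n\<close> may grow with \<open>n\<close>, but their cost is at most
  \<open>z * j n\<close> times the diagonal Green value, which tends to 0. As
  \<open>j n >= 1\<close>, the smallness of \<open>Q\<close> required for the comparison holds
  eventually.\<close>

lemma (in graph_pair) vanishing_compare:
  fixes j :: "nat \<Rightarrow> real" and z :: real
  assumes l: "\<And>n. 0 < l n" "\<And>n. l n \<le> 1/2" and j: "\<And>n. 1 \<le> j n"
    and f: "\<And>n x. 0 \<le> f n x \<and> f n x \<le> 1" and f': "\<And>n x. 0 \<le> f' n x \<and> f' n x \<le> 1"
    and Z: "\<And>n. finite (Z n)" "\<And>n. card (Z n) \<le> z * j n"
    and eq: "\<And>n y. y \<in> D \<Longrightarrow> y \<notin> Z n \<Longrightarrow> f n y = f' n y"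
    and van: "vanishing d N l j f v"
  shows "vanishing d N' l j f' v"
proof -
  have l1: "l n < 1" for n
    using l(2)[of n] by simp
  let ?g = "\<lambda>n. green d N (l n) v v" and ?h = "\<lambda>n. green d N' (l n) v v"
  have g0: "0 \<le> ?g n" and h0: "0 \<le> ?h n" for n
    using G.green_nonneg H.green_nonneg l l1 by auto
  have jg: "(\<lambda>n. j n * ?g n) \<longlonglongrightarrow> 0" and Uf: "(\<lambda>n. resolvent d N (l n) (f n) v) \<longlonglongrightarrow> 0"
    using van by (auto simp: vanishing_def)
  obtain K where K: "K > 0" "\<And>l. 0 < l \<Longrightarrow> l \<le> 1/2 \<Longrightarrow> card Q * green d N l v v \<le> 1/2 \<Longrightarrow>
     green d N' l v v \<le> K * green d N l v v"
     "\<And>l f f' Z. 0 < l \<Longrightarrow> l \<le> 1/2 \<Longrightarrow> card Q * green d N l v v \<le> 1/2 \<Longrightarrow>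
        (\<forall>x. 0 \<le> f x \<and> f x \<le> 1) \<Longrightarrow> (\<forall>x. 0 \<le> f' x \<and> f' x \<le> 1) \<Longrightarrow> finite Z \<Longrightarrow>
        (\<forall>y\<in>D - Z. f y = f' y) \<Longrightarrow>
        resolvent d N' l f' v \<le> K * (resolvent d N l f v + (card Z + card Q) * green d N l v v)"
    using resolvent_compare by metis
  have "(\<lambda>n. card Q * (j n * ?g n)) \<longlonglongrightarrow> 0"
    by (rule tendsto_mult_right_zero[OF jg])
  then have "\<forall>\<^sub>F n in sequentially. card Q * (j n * ?g n) < 1/2"
    by (rule order_tendstoD) simp
  then have small: "\<forall>\<^sub>F n in sequentially. card Q * ?g n \<le> 1/2"
  proof eventually_elim
    case (elim n)
    have "?g n \<le> j n * ?g n"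
      using mult_right_mono[of 1 "j n" "?g n"] j[of n] g0[of n] by simp
    then have "card Q * ?g n \<le> card Q * (j n * ?g n)"
      by (intro mult_left_mono) auto
    with elim show ?case by simp
  qed
  have up1: "\<forall>\<^sub>F n in sequentially. j n * ?h n \<le> K * (j n * ?g n)"
    using small
  proof eventually_elim
    case (elim n)
    show ?case
      using mult_left_mono[OF K(2)[OF l elim], of "j n"] j[of n] by (simp add: mult_ac)
  qed
  have up2: "\<forall>\<^sub>F n in sequentially. resolvent d N' (l n) (f' n) v
      \<le> K * (resolvent d N (l n) (f n) v + (z + card Q) * (j n * ?g n))"
    using small
  proof eventually_elim
    case (elim n)
    have "real (card (Z n)) + real (card Q) \<le> z * j n + card Q * j n"
      using Z(2)[of n] mult_left_mono[of 1 "j n" "real (card Q)"] j[of n] by simp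
    then have "(card (Z n) + card Q) * ?g n \<le> (z * j n + card Q * j n) * ?g n"
      using g0 by (intro mult_right_mono) auto
    also have "\<dots> = (z + card Q) * (j n * ?g n)"
      by (simp add: algebra_simps)
    finally have "resolvent d N (l n) (f n) v + (card (Z n) + card Q) * ?g n
        \<le> resolvent d N (l n) (f n) v + (z + card Q) * (j n * ?g n)"
      by simp
    from mult_left_mono[OF this, of K] K(1) K(3)[OF l elim, of "f n" "f' n" "Z n"] f f' Z(1) eq
    show ?case by (simp add: algebra_simps)
  qed
  have "(\<lambda>n. K * (j n * ?g n)) \<longlonglongrightarrow> 0"
    by (rule tendsto_mult_right_zero[OF jg])
  moreover have "(\<lambda>n. K * (resolvent d N (l n) (f n) v + (z + card Q) * (j n * ?g n))) \<longlonglongrightarrow> 0"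
    by (intro tendsto_mult_right_zero tendsto_add_zero jg Uf)
  moreover have "\<forall>\<^sub>F n in sequentially. 0 \<le> j n * ?h n"
    using j h0 by (intro always_eventually allI mult_nonneg_nonneg) (auto intro: order_trans[OF zero_le_one])
  moreover have "\<forall>\<^sub>F n in sequentially. 0 \<le> resolvent d N' (l n) (f' n) v"
    using l l1 f' by (intro always_eventually allI H.resolvent_nonneg[of _ _ 1]) auto
  ultimately show ?thesis
    unfolding vanishing_def using up1 up2
    by (auto intro: tendsto_sandwich[of "\<lambda>_. 0", OF _ _ tendsto_const])
qed

section \<open>Cluster graphs\<close>

text \<open>A relabelling that carries neighbourhoods to neighbourhoods intertwines the walks.
  Injectivity is asked on a closed set \<open>V\<close> only, since the group action is controlled
  on the carrier only.\<close>

lemma walkpow_transport: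
  assumes V: "\<And>x. x \<in> V \<Longrightarrow> N x \<subseteq> V" "inj_on p V"
    and N': "\<And>x. x \<in> V \<Longrightarrow> N' (p x) = p ` N x"
    and f: "\<And>x. x \<in> V \<Longrightarrow> f' (p x) = f x" and x: "x \<in> V"
  shows "(walk d N' ^^ k) f' (p x) = (walk d N ^^ k) f x"
  using x
proof (induction k arbitrary: x)
  case 0
  then show ?case by (simp add: f)
next
  case (Suc k)
  have "inj_on p (N x)"
    using V Suc.prems by (meson inj_on_subset)
  then show ?case
    using V(1)[OF Suc.prems] Suc by (simp add: walk_def N' sum.reindex subset_iff)
qed

lemma resolvent_transport:
  assumes V: "\<And>x. x \<in> V \<Longrightarrow> N x \<subseteq> V" "inj_on p V"
    and N': "\<And>x. x \<in> V \<Longrightarrow> N' (p x) = p ` N x"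
    and f: "\<And>x. x \<in> V \<Longrightarrow> f' (p x) = f x" and x: "x \<in> V"
  shows "resolvent d N' l f' (p x) = resolvent d N l f x"
proof -
  have "(walk d N' ^^ k) f' (p x) = (walk d N ^^ k) f x" for k
    by (rule walkpow_transport[of V N p N' f' f, OF assms])
  then show ?thesis
    by (simp add: resolvent_def)
qed

lemma green_transport:
  assumes V: "\<And>x. x \<in> V \<Longrightarrow> N x \<subseteq> V" "inj_on p V"
    and N': "\<And>x. x \<in> V \<Longrightarrow> N' (p x) = p ` N x" and x: "x \<in> V" "v \<in> V"
  shows "green d N' l (p v) (p x) = green d N l v x"
  unfolding green_def
  by (rule resolvent_transport[of V N p N', OF V N' _ x(1)])
    (use V(2) x in \<open>auto simp: indicator_def dest: inj_onD\<close>)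

section \<open>Clusters of a configuration\<close>

lemma open_adjacent_sym: "open_adjacent \<Gamma> S I w x y \<Longrightarrow> open_adjacent \<Gamma> S I w y x"
  by (simp add: open_adjacent_def insert_commute)

lemma cluster_eq:
  assumes "y \<in> cluster \<Gamma> S I w x"
  shows "cluster \<Gamma> S I w y = cluster \<Gamma> S I w x"
proof -
  let ?R = "open_adjacent \<Gamma> S I w"
  have sym: "?R\<^sup>*\<^sup>* b a" if "?R\<^sup>*\<^sup>* a b" for a b
    by (rule sympD[OF symp_rtranclp that]) (auto intro: sympI open_adjacent_sym)
  have xy: "?R\<^sup>*\<^sup>* x y" and x: "is_open I w (Vertex x)"
    using assms by (auto simp: cluster_def)
  have "is_open I w (Vertex y)"
    using xy x by (induction rule: rtranclp_induct) (auto simp: open_adjacent_def)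
  with x sym[OF xy] xy show ?thesis
    by (auto simp: cluster_def intro: rtranclp_trans)
qed

section \<open>Walks on the clusters of a labelling, and their equivariance\<close>

locale percolation_map = group \<Gamma> for \<Gamma> :: "('a, 'b) monoid_scheme" (structure) +
  fixes S :: "'a set" and J I :: "'a element set"
    and \<Phi> :: "('a element \<Rightarrow> 'l::polish_space) \<Rightarrow> 'a element \<Rightarrow> bool"
  assumes S: "finite S" "S \<subseteq> carrier \<Gamma>" "generate \<Gamma> S = carrier \<Gamma>"
    and J: "J \<in> {sites \<Gamma>, bonds \<Gamma> S, sites \<Gamma> \<union> bonds \<Gamma> S}"
    and I: "I \<in> {sites \<Gamma>, bonds \<Gamma> S}"
    and \<Phi>: "\<Phi> \<in> labellings J \<rightarrow>\<^sub>M configurations I"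
    and \<Phi>_translate: "\<And>g h. g \<in> carrier \<Gamma> \<Longrightarrow> h \<in> space (labellings J) \<Longrightarrow>
      \<Phi> (translate \<Gamma> J g h) = translate \<Gamma> I g (\<Phi> h)"
begin

abbreviation "L \<equiv> (labellings J :: ('a element \<Rightarrow> 'l) measure)"
abbreviation "act \<equiv> act_vertex \<Gamma>"
abbreviation "tr \<equiv> translate \<Gamma> J"

text \<open>The identity is included so that \<open>deg >= 1\<close> even for an empty generating
  set; the resulting loops contribute 0 to \<open>walk\<close>.\<close>

definition T :: "'a set" where
  "T = insert \<one> (S \<union> m_inv \<Gamma> ` S)"

definition C :: "('a element \<Rightarrow> 'l) \<Rightarrow> 'a \<Rightarrow> 'a set" where
  "C h x = cluster \<Gamma> S I (\<Phi> h) x"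

text \<open>Vertices of one cluster that differ by a generator are joined whether or not the edge
  between them is open. The walk thus depends on the vertex set of the cluster only, and a finite
  symmetric difference of clusters changes finitely many neighbourhoods.\<close>

definition nb :: "('a element \<Rightarrow> 'l) \<Rightarrow> 'a \<Rightarrow> 'a set" where
  "nb h x = {y \<in> C h x. \<exists>s\<in>T. y = s \<otimes> x}"

definition deg :: real where
  "deg = card T"

lemma T: "finite T" "T \<subseteq> carrier \<Gamma>" "\<one> \<in> T" "s \<in> T \<Longrightarrow> inv s \<in> T"
  using S(1,2) by (auto simp: T_def subset_iff)

lemma elements_sub: "J \<subseteq> sites \<Gamma> \<union> bonds \<Gamma> S" "I \<subseteq> sites \<Gamma> \<union> bonds \<Gamma> S"
  using I J by auto

lemma act_closed:
  assumes "g \<in> carrier \<Gamma>"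
  shows "i \<in> I \<Longrightarrow> act_element \<Gamma> g i \<in> I" "i \<in> J \<Longrightarrow> act_element \<Gamma> g i \<in> J"
  using I J act_element_closed[OF is_group S(2) assms] by auto

lemma countable_carrier: "countable (carrier \<Gamma>)"
  by (rule countable_elements(1)[OF S(1,3)])

lemma edge_sub: "e \<in> cayley_edges \<Gamma> S \<Longrightarrow> e \<subseteq> carrier \<Gamma>"
  using S(2) by (auto simp: cayley_edges_def)

lemma act_simps [simp]:
  assumes "g \<in> carrier \<Gamma>" "x \<in> carrier \<Gamma>"
  shows "act g x \<in> carrier \<Gamma>" "act (inv g) (act g x) = x" "act g (act (inv g) x) = x"
    "act g g = \<one>" "act \<one> x = x"
  using assms by (simp_all add: act_vertex_def m_assoc)

lemma act_element_one: "i \<in> sites \<Gamma> \<union> bonds \<Gamma> S \<Longrightarrow> act_element \<Gamma> \<one> i = i"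
proof -
  have "act \<one> ` e = e" if "e \<subseteq> carrier \<Gamma>" for e
    using that by (simp add: subset_iff act_vertex_def)
  then show "i \<in> sites \<Gamma> \<union> bonds \<Gamma> S \<Longrightarrow> act_element \<Gamma> \<one> i = i"
    using edge_sub by (auto simp: sites_def bonds_def)
qed

lemma act_element_inv:
  assumes "g \<in> carrier \<Gamma>" "i \<in> sites \<Gamma> \<union> bonds \<Gamma> S"
  shows "act_element \<Gamma> (inv g) (act_element \<Gamma> g i) = i"
  using assms act_element_mult[OF is_group S(2) _ assms(1,2), of "inv g"] act_element_one[of i] by simp

lemma measurable_tr [measurable]: "g \<in> carrier \<Gamma> \<Longrightarrow> tr g \<in> L \<rightarrow>\<^sub>M L"
  unfolding labellings_def by (rule measurable_translate[OF is_group]) (auto intro: act_closed)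

lemma space_tr: "g \<in> carrier \<Gamma> \<Longrightarrow> h \<in> space L \<Longrightarrow> tr g h \<in> space L"
  by (rule measurable_space[OF measurable_tr])

lemma tr_mult: "g \<in> carrier \<Gamma> \<Longrightarrow> k \<in> carrier \<Gamma> \<Longrightarrow> tr g (tr k h) = tr (g \<otimes> k) h"
  by (rule translate_mult[OF is_group S(2) _ _ elements_sub(1)]) (auto intro: act_closed)

lemma tr_one: "h \<in> space L \<Longrightarrow> tr \<one> h = h"
  using elements_sub(1) act_element_one
  by (auto simp: labellings_def space_PiM PiE_def translate_def extensional_def fun_eq_iff subset_iff)

lemma tr_act: "g \<in> carrier \<Gamma> \<Longrightarrow> y \<in> carrier \<Gamma> \<Longrightarrow> tr (act g y) (tr g h) = tr y h"
  by (simp add: tr_mult) (simp add: act_vertex_def m_assoc)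

lemma C_sub: "C h x \<subseteq> carrier \<Gamma>"
  by (auto simp: C_def cluster_def)

lemma C_carrier:
  assumes "y \<in> C h x"
  shows "x \<in> carrier \<Gamma>"
proof -
  have "(open_adjacent \<Gamma> S I (\<Phi> h))\<^sup>*\<^sup>* x y" "y \<in> carrier \<Gamma>"
    using assms by (auto simp: C_def cluster_def)
  from this(1) show ?thesis
  proof (cases rule: converse_rtranclpE)
    case base
    then show ?thesis using \<open>y \<in> carrier \<Gamma>\<close> by simp
  next
    case (step z)
    then show ?thesis using edge_sub[of "{x, z}"] by (simp add: open_adjacent_def)
  qed
qed

lemma C_eq: "y \<in> C h x \<Longrightarrow> C h y = C h x"
  unfolding C_def by (rule cluster_eq)

lemma C_refl: "y \<in> C h x \<Longrightarrow> x \<in> C h x"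
  using C_carrier[of y h x] by (auto simp: C_def cluster_def)

lemma C_sym: "y \<in> C h x \<Longrightarrow> x \<in> C h y"
  using C_refl C_eq by blast

lemma is_open_translate:
  assumes "g \<in> carrier \<Gamma>" "i \<in> sites \<Gamma> \<union> bonds \<Gamma> S"
  shows "is_open I (translate \<Gamma> I g w) (act_element \<Gamma> g i) \<longleftrightarrow> is_open I w i"
proof -
  have "act_element \<Gamma> g i \<in> I \<longleftrightarrow> i \<in> I"
    using act_closed(1)[OF assms(1), of i] act_closed(1)[of "inv g" "act_element \<Gamma> g i"]
      act_element_inv[OF assms] assms(1) by auto
  then show ?thesis
    using act_element_inv[OF assms] by (auto simp: is_open_def translate_def)
qed

lemma open_adjacent_translate:
  assumes g: "g \<in> carrier \<Gamma>" and xy: "open_adjacent \<Gamma> S I w x y"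
  shows "open_adjacent \<Gamma> S I (translate \<Gamma> I g w) (act g x) (act g y)"
proof -
  have e: "{x, y} \<in> cayley_edges \<Gamma> S" using xy by (simp add: open_adjacent_def)
  then have x: "x \<in> carrier \<Gamma>" "y \<in> carrier \<Gamma>" using edge_sub by blast+
  then have m: "Vertex x \<in> sites \<Gamma> \<union> bonds \<Gamma> S" "Vertex y \<in> sites \<Gamma> \<union> bonds \<Gamma> S"
      "Edge {x, y} \<in> sites \<Gamma> \<union> bonds \<Gamma> S"
    using e by (auto simp: sites_def bonds_def)
  have "Edge {act g x, act g y} \<in> bonds \<Gamma> S"
    using act_element_closed(2)[OF is_group S(2) g, of "Edge {x, y}"] e by (auto simp: bonds_def)
  then have "{act g x, act g y} \<in> cayley_edges \<Gamma> S"
    by (auto simp: bonds_def)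
  then show ?thesis
    using xy m[THEN is_open_translate[OF g, of _ w]] by (simp add: open_adjacent_def)
qed

lemma C_tr_imp:
  assumes g: "g \<in> carrier \<Gamma>" and h: "h \<in> space L" and y: "y \<in> C h x"
  shows "act g y \<in> C (tr g h) (act g x)"
proof -
  have x: "x \<in> carrier \<Gamma>" by (rule C_carrier[OF y])
  have "(open_adjacent \<Gamma> S I (\<Phi> h))\<^sup>*\<^sup>* x y" "is_open I (\<Phi> h) (Vertex x)" "y \<in> carrier \<Gamma>"
    using y by (auto simp: C_def cluster_def)
  from this(1) have "(open_adjacent \<Gamma> S I (translate \<Gamma> I g (\<Phi> h)))\<^sup>*\<^sup>* (act g x) (act g y)"
    by induction (auto intro: rtranclp.rtrancl_into_rtrancl open_adjacent_translate[OF g])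
  moreover have "is_open I (translate \<Gamma> I g (\<Phi> h)) (Vertex (act g x))"
    using is_open_translate[OF g, of "Vertex x" "\<Phi> h"] x \<open>is_open I (\<Phi> h) (Vertex x)\<close>
    by (simp add: sites_def)
  ultimately show ?thesis
    using g h \<open>y \<in> carrier \<Gamma>\<close> by (simp add: C_def cluster_def \<Phi>_translate)
qed

text \<open>The reverse inclusion is \<open>C_tr_imp\<close> applied to the inverse element.\<close>

lemma C_tr:
  assumes g: "g \<in> carrier \<Gamma>" and h: "h \<in> space L" and x: "x \<in> carrier \<Gamma>"
  shows "C (tr g h) (act g x) = act g ` C h x"
proof (intro equalityI subsetI)
  fix z assume z: "z \<in> C (tr g h) (act g x)"
  then have zc: "z \<in> carrier \<Gamma>" using C_sub by blast
  have "act (inv g) z \<in> C (tr (inv g) (tr g h)) (act (inv g) (act g x))"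
    using g h z by (intro C_tr_imp space_tr) auto
  then have "act (inv g) z \<in> C h x"
    using g h x by (simp add: tr_mult tr_one)
  then show "z \<in> act g ` C h x"
    using g zc by (intro image_eqI[of _ _ "act (inv g) z"]) auto
qed (use C_tr_imp[OF g h] in auto)

lemma inj_act: "g \<in> carrier \<Gamma> \<Longrightarrow> inj_on (act g) (carrier \<Gamma>)"
  by (rule inj_on_inverseI[of _ "act (inv g)"]) simp

lemma nb_tr:
  assumes g: "g \<in> carrier \<Gamma>" and h: "h \<in> space L" and x: "x \<in> carrier \<Gamma>"
  shows "nb (tr g h) (act g x) = act g ` nb h x"
proof -
  have "(\<exists>s\<in>T. act g y = s \<otimes> act g x) \<longleftrightarrow> (\<exists>s\<in>T. y = s \<otimes> x)" if "y \<in> carrier \<Gamma>" for y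
  proof -
    have "s \<otimes> act g x = act g (s \<otimes> x)" if "s \<in> T" for s
      using that g x T(2) by (auto simp: act_vertex_def m_assoc subset_iff)
    moreover have "act g y = act g (s \<otimes> x) \<longleftrightarrow> y = s \<otimes> x" if "s \<in> T" for s
      using inj_act[OF g] \<open>y \<in> carrier \<Gamma>\<close> that x T(2) by (auto simp: inj_on_eq_iff subset_iff)
    ultimately show ?thesis by auto
  qed
  then show ?thesis
    unfolding nb_def C_tr[OF assms] using C_sub[of h x] by auto
qed

lemma nb_alt: "x \<in> carrier \<Gamma> \<Longrightarrow> nb h x = {y \<in> (\<lambda>s. s \<otimes> x) ` T. y \<in> C h x}"
  by (auto simp: nb_def)

lemma nb_subset: "nb h x \<subseteq> C h x" "nb h x \<subseteq> carrier \<Gamma>"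
  using C_sub by (auto simp: nb_def)

lemma bounded_graph_nb: "bounded_graph (nb h) deg"
proof
  fix x y
  have sub: "nb h x \<subseteq> (\<lambda>s. s \<otimes> x) ` T"
    by (auto simp: nb_def)
  then show "finite (nb h x)"
    using T(1) finite_subset by blast
  have "card (nb h x) \<le> card T"
    using card_mono[OF _ sub] card_image_le[OF T(1)] T(1) order_trans by blast
  then show "card (nb h x) \<le> deg"
    by (simp add: deg_def)
  show "x \<in> nb h y" if y: "y \<in> nb h x"
  proof -
    obtain s where s: "s \<in> T" "y = s \<otimes> x" "y \<in> C h x"
      using y by (auto simp: nb_def)
    have "s \<in> carrier \<Gamma>" "x \<in> carrier \<Gamma>"
      using s T(2) C_carrier by auto
    then have "x = inv s \<otimes> y"
      using s(2) by (simp add: inv_solve_left)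
    with T(4)[OF s(1)] C_sym[OF s(3)] show ?thesis
      by (auto simp: nb_def)
  qed
next
  show "1 \<le> deg"
    using T(1,3) card_gt_0_iff[of T] by (auto simp: deg_def Suc_le_eq)
qed

sublocale nb: bounded_graph "nb h" deg for h
  by (rule bounded_graph_nb)

text \<open>Every open edge is a step by a generator or, as edges are unordered, by its inverse. So
  the walk graph connects the cluster.\<close>

lemma reach_C:
  assumes "y \<in> C h x"
  shows "reach (nb h) x y"
proof -
  have "(open_adjacent \<Gamma> S I (\<Phi> h))\<^sup>*\<^sup>* x y"
    using assms by (auto simp: C_def cluster_def)
  then show ?thesis
    unfolding reach_def
  proof (induction rule: rtranclp_induct)
    case (step y z)
    have e: "{y, z} \<in> cayley_edges \<Gamma> S"
      using step(2) by (simp add: open_adjacent_def)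
    then have c: "y \<in> carrier \<Gamma>" "z \<in> carrier \<Gamma>" using edge_sub by blast+
    obtain u s where u: "{y, z} = {u, s \<otimes> u}" "u \<in> carrier \<Gamma>" "s \<in> S"
      using e by (auto simp: cayley_edges_def)
    have s: "s \<in> carrier \<Gamma>" using u S(2) by blast
    have "z = s \<otimes> y \<or> z = inv s \<otimes> y"
      using u c s by (auto simp: doubleton_eq_iff inv_solve_left)
    then have "\<exists>t\<in>T. z = t \<otimes> y"
      using u(3) by (auto simp: T_def)
    moreover have "z \<in> C h y"
      using step(2) c by (auto simp: C_def cluster_def open_adjacent_def)
    ultimately have "z \<in> nb h y" by (simp add: nb_def)
    with step(3) show ?case
      by (rule rtranclp.rtrancl_into_rtrancl)
  qed simp
qed

lemma C_reach: "reach (nb h) x y \<Longrightarrow> y = x \<or> y \<in> C h x"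
  unfolding reach_def
proof (induction rule: rtranclp_induct)
  case (step y z)
  then show ?case
    using C_eq[of y h x] by (auto simp: nb_def)
qed simp

text \<open>\<open>Q\<close> consists of the identity, the symmetric difference \<open>E\<close> and
  all vertices one generator step from \<open>E\<close>. A vertex outside \<open>Q\<close> sees no
  vertex on which the two clusters disagree.\<close>

lemma graph_pair_nb:
  assumes C: "\<one> \<in> C h \<one>" "\<one> \<in> C h' \<one>"
    and fin: "finite ((C h \<one> - C h' \<one>) \<union> (C h' \<one> - C h \<one>))"
  defines "E \<equiv> (C h \<one> - C h' \<one>) \<union> (C h' \<one> - C h \<one>)"
  shows "graph_pair (nb h) (nb h') deg (C h \<one> \<inter> C h' \<one>)
    (insert \<one> (E \<union> (\<lambda>(s, z). inv s \<otimes> z) ` (T \<times> E))) \<one>"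
    (is "graph_pair _ _ _ ?D ?Q _")
proof
  show "finite ?Q"
    using fin T(1) by (auto simp: E_def)
  show "\<one> \<in> ?D" "\<one> \<in> ?Q"
    using C by auto
  show "reach (nb h) \<one> x" "reach (nb h') \<one> x" if "x \<in> ?D" for x
    using that by (auto intro: reach_C)
  show "x \<in> ?D \<union> ?Q" if "reach (nb h) \<one> x" for x
    using C_reach[OF that] C by (auto simp: E_def)
  show "x \<in> ?D \<union> ?Q" if "reach (nb h') \<one> x" for x
    using C_reach[OF that] C by (auto simp: E_def)
  show "nb h x = nb h' x \<and> nb h x \<subseteq> ?D" if x: "x \<in> ?D" "x \<notin> ?Q" for x
  proof -
    have xc: "x \<in> carrier \<Gamma>" using x C_sub by blast
    have eq: "C h x = C h \<one>" "C h' x = C h' \<one>"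
      using C_eq[of x h \<one>] C_eq[of x h' \<one>] x(1) by simp_all
    have "s \<otimes> x \<notin> E" if "s \<in> T" for s
    proof
      assume "s \<otimes> x \<in> E"
      moreover have "x = inv s \<otimes> (s \<otimes> x)"
        using that xc T(2) by (auto simp: subset_iff simp flip: m_assoc)
      ultimately have "x \<in> ?Q"
        using that by force
      with x show False by blast
    qed
    then have "s \<otimes> x \<in> C h \<one> \<longleftrightarrow> s \<otimes> x \<in> C h' \<one>" if "s \<in> T" for s
      using that unfolding E_def by blast
    then show ?thesis
      unfolding nb_def eq by auto
  qed
qed

lemma resolvent_tr:
  assumes g: "g \<in> carrier \<Gamma>" and h: "h \<in> space L" and x: "x \<in> carrier \<Gamma>"
    and f: "\<And>x. x \<in> carrier \<Gamma> \<Longrightarrow> f' (act g x) = f x"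
  shows "resolvent deg (nb (tr g h)) l f' (act g x) = resolvent deg (nb h) l f x"
  by (rule resolvent_transport[of "carrier \<Gamma>"]) (use assms nb_subset inj_act nb_tr in auto)

lemma green_tr:
  assumes g: "g \<in> carrier \<Gamma>" and h: "h \<in> space L" and x: "x \<in> carrier \<Gamma>" "v \<in> carrier \<Gamma>"
  shows "green deg (nb (tr g h)) l (act g v) (act g x) = green deg (nb h) l v x"
  by (rule green_transport[of "carrier \<Gamma>"]) (use assms nb_subset inj_act nb_tr in auto)

section \<open>Measurability in the labelling\<close>

lemma pred_C [measurable]: "Measurable.pred L (\<lambda>h. y \<in> C h x)"
proof -
  have comp: "Measurable.pred L (\<lambda>h. is_open I (\<Phi> h) i)" for i
  proof (cases "i \<in> I")
    case True
    have "(\<lambda>h. \<Phi> h i) \<in> L \<rightarrow>\<^sub>M count_space UNIV"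
      using measurable_compose[OF \<Phi>[unfolded configurations_def] measurable_component_singleton[OF True]] .
    then show ?thesis using True by (simp add: is_open_def)
  qed (simp add: is_open_def)
  have adj: "Measurable.pred L (\<lambda>h. open_adjacent \<Gamma> S I (\<Phi> h) x y)" for x y
    unfolding open_adjacent_def using comp[measurable] by measurable
  have path: "Measurable.pred L (\<lambda>h. (open_adjacent \<Gamma> S I (\<Phi> h) ^^ n) x y)" for n x y
  proof (induction n arbitrary: y)
    case (Suc n)
    \<comment> \<open>The last vertex but one ranges over the countable carrier because edges stay
      in it. The existential is a negated bounded universal to fit
      \<open>pred_ball_countable\<close>.\<close>
    have "(open_adjacent \<Gamma> S I (\<Phi> h) ^^ Suc n) x y \<longleftrightarrow>
        \<not> (\<forall>z\<in>carrier \<Gamma>. \<not> ((open_adjacent \<Gamma> S I (\<Phi> h) ^^ n) x z \<and> open_adjacent \<Gamma> S I (\<Phi> h) z y))" for h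
      using edge_sub[of "{_, y}"] by (auto simp: open_adjacent_def elim!: relcomppE)
    moreover have "Measurable.pred L (\<lambda>h. \<not> (\<forall>z\<in>carrier \<Gamma>. \<not> ((open_adjacent \<Gamma> S I (\<Phi> h) ^^ n) x z \<and> open_adjacent \<Gamma> S I (\<Phi> h) z y)))"
      by (intro pred_intros_logic pred_ball_countable[OF countable_carrier] Suc.IH adj)
    ultimately show ?case by simp
  qed simp
  show ?thesis
    unfolding C_def cluster_def rtranclp_power mem_Collect_eq
    by (intro pred_intros_logic pred_intros_countable comp path) simp_all
qed

lemma measurable_walkpow:
  assumes f: "\<And>x. x \<in> carrier \<Gamma> \<Longrightarrow> (\<lambda>h. f h x) \<in> borel_measurable L" and x: "x \<in> carrier \<Gamma>"
  shows "(\<lambda>h. (walk deg (nb h) ^^ k) (f h) x) \<in> borel_measurable L"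
  using x
proof (induction k arbitrary: x)
  case (Suc k)
  let ?W = "\<lambda>h. (walk deg (nb h) ^^ k) (f h)"
  have sub: "y \<in> (\<lambda>s. s \<otimes> x) ` T \<Longrightarrow> y \<in> carrier \<Gamma>" for y
    using Suc.prems T(2) by auto
  have "(walk deg (nb h) ^^ Suc k) (f h) x
      = ?W h x + (\<Sum>y\<in>(\<lambda>s. s \<otimes> x) ` T. if y \<in> C h x then ?W h y - ?W h x else 0) / deg" for h
    using T(1) by (simp add: walk_def nb_alt[OF Suc.prems] sum.inter_filter)
  moreover have "(\<lambda>h. ?W h x + (\<Sum>y\<in>(\<lambda>s. s \<otimes> x) ` T. if y \<in> C h x then ?W h y - ?W h x else 0) / deg) \<in> borel_measurable L"
    by (intro borel_measurable_add borel_measurable_divide borel_measurable_sum measurable_If borel_measurable_diff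
        Suc.IH Suc.prems borel_measurable_const) (auto simp: pred_C[unfolded pred_def] sub)
  ultimately show ?case by simp
qed (simp add: f)

lemma measurable_resolvent:
  assumes f: "\<And>x. x \<in> carrier \<Gamma> \<Longrightarrow> (\<lambda>h. f h x) \<in> borel_measurable L" and x: "x \<in> carrier \<Gamma>"
  shows "(\<lambda>h. resolvent deg (nb h) l (f h) x) \<in> borel_measurable L"
  unfolding resolvent_def using measurable_walkpow[OF assms] by measurable

lemma measurable_green:
  assumes "x \<in> carrier \<Gamma>"
  shows "(\<lambda>h. green deg (nb h) l v x) \<in> borel_measurable L"
  unfolding green_def by (rule measurable_resolvent[OF _ assms]) simp

text \<open>Under an enumeration of the countable carrier, being infinite means having unbounded
  indices, which is a countable condition.\<close>

lemma pred_infinite_C: "Measurable.pred L (\<lambda>h. infinite (C h x))"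
proof -
  let ?e = "to_nat_on (carrier \<Gamma>)"
  have "infinite (C h x) \<longleftrightarrow> (\<forall>n. \<not> (\<forall>y\<in>carrier \<Gamma>. \<not> (n < ?e y \<and> y \<in> C h x)))" for h
  proof -
    have "inj_on ?e (C h x)"
      using inj_on_to_nat_on[OF countable_carrier] C_sub by (rule inj_on_subset)
    then have "infinite (C h x) \<longleftrightarrow> infinite (?e ` C h x)"
      by (simp add: finite_image_iff)
    also have "\<dots> \<longleftrightarrow> (\<forall>n. \<exists>k>n. k \<in> ?e ` C h x)"
      by (simp add: infinite_nat_iff_unbounded)
    also have "\<dots> \<longleftrightarrow> (\<forall>n. \<not> (\<forall>y\<in>carrier \<Gamma>. \<not> (n < ?e y \<and> y \<in> C h x)))"
      using C_sub[of h x] by blast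
    finally show ?thesis .
  qed
  moreover have "Measurable.pred L (\<lambda>h. \<forall>n. \<not> (\<forall>y\<in>carrier \<Gamma>. \<not> (n < ?e y \<and> y \<in> C h x)))"
    by (intro pred_intros_logic pred_intros_countable pred_ball_countable[OF countable_carrier] pred_C measurable_const) auto
  ultimately show ?thesis by simp
qed

end

section \<open>Finite approximation and mass transport\<close>

text \<open>The sets that can be approximated to every accuracy form a sigma-algebra containing the
  one-coordinate sets, which generate the product.\<close>

lemma finite_coordinates_approximation:
  assumes "finite_measure M" and sets_M: "sets M = sets (PiM J N)" and A: "A \<in> sets M" and e: "0 < (e::real)"
  shows "\<exists>K B. finite K \<and> K \<subseteq> J \<and> B \<in> sets M \<and>
    (\<forall>x\<in>space M. \<forall>y\<in>space M. (\<forall>i\<in>K. x i = y i) \<longrightarrow> (x \<in> B \<longleftrightarrow> y \<in> B)) \<and>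
    measure M ((A - B) \<union> (B - A)) < e"
proof -
  interpret finite_measure M by fact
  have sp: "space M = (\<Pi>\<^sub>E i\<in>J. space (N i))"
    using sets_eq_imp_space_eq[OF sets_M] by (simp add: space_PiM)
  define approx where "approx A e \<longleftrightarrow> (\<exists>K B. finite K \<and> K \<subseteq> J \<and> B \<in> sets M \<and>
    (\<forall>x\<in>space M. \<forall>y\<in>space M. (\<forall>i\<in>K. x i = y i) \<longrightarrow> (x \<in> B \<longleftrightarrow> y \<in> B)) \<and>
    measure M ((A - B) \<union> (B - A)) < e)" for A and e :: real
  have "A \<in> sigma_sets (space M) {{f\<in>space M. f i \<in> A} | i A. i \<in> J \<and> A \<in> sets (N i)}"
    using A unfolding sets_M sets_PiM_single sp .
  then have "A \<in> sets M \<and> (\<forall>e>0. approx A e)"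
  proof (induction rule: sigma_sets.induct)
    case (Basic a)
    then obtain i X where i: "a = {f\<in>space M. f i \<in> X}" "i \<in> J" "X \<in> sets (N i)"
      by blast
    have a: "a \<in> sets M"
      using Basic unfolding sets_M sets_PiM_single sp by blast
    moreover have "approx a e" if "0 < e" for e
      unfolding approx_def by (rule exI[of _ "{i}"], rule exI[of _ a]) (use a i that in auto)
    ultimately show ?case by blast
  next
    case Empty
    have "approx {} e" if "0 < e" for e
      unfolding approx_def by (rule exI[of _ "{}"], rule exI[of _ "{}"]) (use that in auto)
    then show ?case by blast
  next
    case (Compl a)
    have "approx (space M - a) e" if e: "0 < e" for e
    proof -
      obtain K B where K: "finite K" "K \<subseteq> J" "B \<in> sets M"
        "\<forall>x\<in>space M. \<forall>y\<in>space M. (\<forall>i\<in>K. x i = y i) \<longrightarrow> (x \<in> B \<longleftrightarrow> y \<in> B)"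
        "measure M ((a - B) \<union> (B - a)) < e"
        using Compl e unfolding approx_def by blast
      have sub: "a \<subseteq> space M" "B \<subseteq> space M"
        using Compl K(3) sets.sets_into_space by auto
      then have eq: "((space M - a) - (space M - B)) \<union> ((space M - B) - (space M - a)) = (a - B) \<union> (B - a)"
        by blast
      show ?thesis
        unfolding approx_def
      proof (intro exI[of _ K] exI[of _ "space M - B"] conjI ballI impI)
        show "x \<in> space M - B \<longleftrightarrow> y \<in> space M - B"
          if "x \<in> space M" "y \<in> space M" "\<forall>i\<in>K. x i = y i" for x y
          using K(4) that by blast
      qed (use K eq in auto)
    qed
    then show ?case using Compl by auto
  next
    case (Union a)
    have a: "a i \<in> sets M" for i using Union by blast
    have "approx (\<Union>i. a i) e" if e: "0 < e" for e
    proof -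
      let ?U = "\<Union>i. a i" and ?V = "\<lambda>n. \<Union>i<n. a i"
      have "(\<lambda>n. measure M (?V n)) \<longlonglongrightarrow> measure M (\<Union>n. ?V n)"
        using a by (intro finite_Lim_measure_incseq incseq_SucI) (auto simp: less_Suc_eq)
      also have "(\<Union>n. ?V n) = ?U" by auto
      finally have "\<forall>\<^sub>F n in sequentially. measure M ?U - e/2 < measure M (?V n)"
        by (rule order_tendstoD) (use e in simp)
      then obtain n where n: "measure M ?U - e/2 < measure M (?V n)"
        by (auto simp: eventually_sequentially)
      have "measure M (?U - ?V n) = measure M ?U - measure M (?V n)"
        using a by (intro finite_measure_Diff) auto
      with n have m1: "measure M (?U - ?V n) < e/2" by simp
      \<comment> \<open>Half of \<open>e\<close> is spent on truncating the union; the other half is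
        shared among \<open>n\<close> sets, with \<open>n + 1\<close> in the denominator so that
        \<open>n = 0\<close> is harmless.\<close>
      have "\<forall>i. approx (a i) (e / (2 * (real n + 1)))"
        using Union e by auto
      then obtain K B where K: "\<And>i. finite (K i)" "\<And>i. K i \<subseteq> J" "\<And>i. B i \<in> sets M"
        "\<And>i x y. x \<in> space M \<Longrightarrow> y \<in> space M \<Longrightarrow> (\<forall>j\<in>K i. x j = y j) \<Longrightarrow> (x \<in> B i \<longleftrightarrow> y \<in> B i)"
        "\<And>i. measure M ((a i - B i) \<union> (B i - a i)) < e / (2 * (real n + 1))"
        unfolding approx_def by metis
      let ?B = "\<Union>i<n. B i" and ?D = "\<lambda>i. (a i - B i) \<union> (B i - a i)"
      have D: "?D i \<in> sets M" for i using a K(3) by auto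
      have "measure M ((?U - ?B) \<union> (?B - ?U)) \<le> measure M ((?U - ?V n) \<union> (\<Union>i<n. ?D i))"
      proof (rule finite_measure_mono)
        show "(?U - ?V n) \<union> (\<Union>i<n. ?D i) \<in> sets M"
          using a D by blast
      qed blast
      also have "\<dots> \<le> measure M (?U - ?V n) + measure M (\<Union>i<n. ?D i)"
        using a D by (intro measure_Un_le) auto
      also have "measure M (\<Union>i<n. ?D i) \<le> (\<Sum>i<n. measure M (?D i))"
        using D by (intro finite_measure_subadditive_finite) auto
      also have "\<dots> \<le> (\<Sum>i<n. e / (2 * (real n + 1)))"
        using K(5) by (intro sum_mono less_imp_le) auto
      also have "\<dots> \<le> e / 2"
        using e by (simp add: field_simps)
      finally have small: "measure M ((?U - ?B) \<union> (?B - ?U)) < e"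
        using m1 by simp
      have coord: "x \<in> ?B \<longleftrightarrow> y \<in> ?B"
        if "x \<in> space M" "y \<in> space M" "\<forall>j\<in>\<Union>i<n. K i. x j = y j" for x y
      proof -
        have "x \<in> B i \<longleftrightarrow> y \<in> B i" if "i < n" for i
          by (rule K(4)) (use \<open>x \<in> space M\<close> \<open>y \<in> space M\<close> \<open>\<forall>j\<in>_. _\<close> that in auto)
        then show ?thesis by blast
      qed
      show ?thesis
        unfolding approx_def
      proof (intro exI[of _ "\<Union>i<n. K i"] exI[of _ ?B] conjI ballI impI)
        show "finite (\<Union>i<n. K i)" "(\<Union>i<n. K i) \<subseteq> J" "?B \<in> sets M"
          using K(1-3) by auto
      qed (fact coord small)+
    qed
    then show ?case using a by blast
  qed
  then show ?thesis
    using e unfolding approx_def by blast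
qed

section \<open>Invariant laws and mass transport\<close>

locale stationary_percolation = percolation_map \<Gamma> S J I \<Phi> + prob_space \<mu>
  for \<Gamma> :: "('a, 'b) monoid_scheme" (structure) and S J I
    and \<Phi> :: "('a element \<Rightarrow> 'l::polish_space) \<Rightarrow> 'a element \<Rightarrow> bool"
    and \<mu> :: "('a element \<Rightarrow> 'l) measure" +
  assumes sets_\<mu> [measurable_cong]: "sets \<mu> = sets L"
    and invariant: "\<And>g. g \<in> carrier \<Gamma> \<Longrightarrow> distr \<mu> L (tr g) = \<mu>"
begin

lemma space_\<mu>: "space \<mu> = space L"
  by (rule sets_eq_imp_space_eq[OF sets_\<mu>])

lemma expectation_tr:
  fixes f :: "_ \<Rightarrow> real"
  assumes g: "g \<in> carrier \<Gamma>" and f: "f \<in> borel_measurable L"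
  shows "expectation (\<lambda>h. f (tr g h)) = expectation f"
proof -
  have "tr g \<in> \<mu> \<rightarrow>\<^sub>M L"
    using measurable_tr[OF g] by (simp add: measurable_cong_sets[OF sets_\<mu> refl])
  from integral_distr[OF this f] show ?thesis
    by (simp add: invariant[OF g])
qed

text \<open>Diagonally invariant observables of a labelling and a vertex. The bounds hold at all
  arguments, because the resolvent estimates ask for them at every vertex, not just in the
  carrier.\<close>

definition diagonal :: "(('a element \<Rightarrow> 'l) \<Rightarrow> 'a \<Rightarrow> real) \<Rightarrow> bool" where
  "diagonal F \<longleftrightarrow> (\<forall>x\<in>carrier \<Gamma>. (\<lambda>h. F h x) \<in> borel_measurable L) \<and>
     (\<forall>h x. 0 \<le> F h x \<and> F h x \<le> 1) \<and>
     (\<forall>g\<in>carrier \<Gamma>. \<forall>h\<in>space L. \<forall>x\<in>carrier \<Gamma>. F (tr g h) (act g x) = F h x)"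

lemma diagonal_integrable:
  assumes "diagonal F" "x \<in> carrier \<Gamma>"
  shows "integrable \<mu> (\<lambda>h. F h x)"
proof (rule integrable_const_bound[of _ 1])
  show "(\<lambda>h. F h x) \<in> borel_measurable \<mu>"
    using assms by (simp add: diagonal_def measurable_cong_sets[OF sets_\<mu> refl])
qed (use assms in \<open>auto simp: diagonal_def\<close>)

lemma diagonal_walkpow:
  assumes F: "diagonal F"
  shows "diagonal (\<lambda>h. (walk deg (nb h) ^^ k) (F h))"
  unfolding diagonal_def
proof (intro conjI ballI allI)
  fix x assume x: "x \<in> carrier \<Gamma>"
  show "(\<lambda>h. (walk deg (nb h) ^^ k) (F h) x) \<in> borel_measurable L"
    using F x by (intro measurable_walkpow) (auto simp: diagonal_def)
  fix g h assume g: "g \<in> carrier \<Gamma>" and h: "h \<in> space L"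
  show "(walk deg (nb (tr g h)) ^^ k) (F (tr g h)) (act g x) = (walk deg (nb h) ^^ k) (F h) x"
    by (rule walkpow_transport[of "carrier \<Gamma>"])
      (use g h x F nb_subset inj_act nb_tr in \<open>auto simp: diagonal_def\<close>)
next
  fix h x
  show "0 \<le> (walk deg (nb h) ^^ k) (F h) x"
    using F by (intro nb.walkpow_nonneg) (auto simp: diagonal_def)
  show "(walk deg (nb h) ^^ k) (F h) x \<le> 1"
    using nb.walkpow_mono[of "F h" "\<lambda>_. 1" k h x] F by (auto simp: diagonal_def)
qed

lemma nb_one: "nb h \<one> = {y \<in> T. y \<in> C h \<one>}"
  using T(2) by (auto simp: nb_def subset_iff)

text \<open>Mass transport: the mass received by \<^term>\<open>\<one>\<close> along the generator \<open>s\<close>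
  has the same expectation as the mass sent along \<open>inv s\<close>.\<close>

lemma expectation_walk:
  assumes F: "diagonal F"
  shows "expectation (\<lambda>h. walk deg (nb h) (F h) \<one>) = expectation (\<lambda>h. F h \<one>)"
proof -
  let ?G = "\<lambda>y h. if y \<in> C h \<one> then F h \<one> else (0::real)"
  let ?H = "\<lambda>y h. if y \<in> C h \<one> then F h y else (0::real)"
  have Fm: "(\<lambda>h. F h x) \<in> borel_measurable L" if "x \<in> carrier \<Gamma>" for x
    using F that by (simp add: diagonal_def)
  have m: "(\<lambda>h. if y \<in> C h z then F h x else 0) \<in> borel_measurable L" if "x \<in> carrier \<Gamma>" for x y z
    using Fm[OF that] by (intro measurable_If) (auto simp: pred_C[unfolded pred_def])
  have int: "integrable \<mu> (\<lambda>h. if y \<in> C h z then F h x else 0)" if "x \<in> carrier \<Gamma>" for x y z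
    by (rule integrable_const_bound[of _ 1])
      (use F m[OF that] in \<open>auto simp: diagonal_def measurable_cong_sets[OF sets_\<mu> refl]\<close>)
  have HG: "expectation (?H y) = expectation (?G (inv y))" if y: "y \<in> carrier \<Gamma>" for y
  proof -
    \<comment> \<open>Translation by \<open>y\<close> takes \<open>y\<close> to the identity and the
      identity to \<open>inv y\<close>.\<close>
    have "?H y h = (if \<one> \<in> C (tr y h) (inv y) then F (tr y h) \<one> else 0)" if h: "h \<in> space L" for h
    proof -
      have "y \<in> C h \<one> \<longleftrightarrow> act y y \<in> C (tr y h) (act y \<one>)"
        unfolding C_tr[OF y h one_closed]
        by (rule inj_on_image_mem_iff[OF inj_act[OF y] y C_sub, symmetric])
      moreover have "F (tr y h) (act y y) = F h y"
        using F y h unfolding diagonal_def by blast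
      moreover have "act y \<one> = inv y" "act y y = \<one>"
        using y by (simp_all add: act_vertex_def)
      ultimately show ?thesis by simp
    qed
    then have "expectation (?H y) = expectation (\<lambda>h. (\<lambda>h. if \<one> \<in> C h (inv y) then F h \<one> else 0) (tr y h))"
      by (intro Bochner_Integration.integral_cong refl) (simp add: space_\<mu>)
    also have "\<dots> = expectation (\<lambda>h. if \<one> \<in> C h (inv y) then F h \<one> else 0)"
      by (rule expectation_tr[OF y m]) simp
    also have "\<dots> = expectation (?G (inv y))"
    proof -
      have "\<one> \<in> C h (inv y) \<longleftrightarrow> inv y \<in> C h \<one>" for h
        by (auto intro: C_sym)
      then show ?thesis by simp
    qed
    finally show ?thesis .
  qed
  have "(\<Sum>y\<in>T. expectation (?H y)) = (\<Sum>y\<in>T. expectation (?G (inv y)))"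
    using T(2) by (intro sum.cong refl HG) auto
  also have "\<dots> = (\<Sum>y\<in>T. expectation (?G y))"
    by (rule sum.reindex_bij_witness[of _ "m_inv \<Gamma>" "m_inv \<Gamma>"]) (use T in \<open>auto simp: subset_iff\<close>)
  finally have eq: "(\<Sum>y\<in>T. expectation (?H y)) - (\<Sum>y\<in>T. expectation (?G y)) = 0"
    by simp
  \<comment> \<open>The random neighbourhood is replaced by the fixed set \<open>T\<close> with
    indicator weights, so that the expectation can enter the sum.\<close>
  have "walk deg (nb h) (F h) \<one> = F h \<one> + ((\<Sum>y\<in>T. ?H y h) - (\<Sum>y\<in>T. ?G y h)) / deg" for h
    using T(1) by (simp add: walk_def nb_one sum.inter_filter flip: sum_subtractf) (auto intro!: sum.cong)
  then have "expectation (\<lambda>h. walk deg (nb h) (F h) \<one>)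
      = expectation (\<lambda>h. F h \<one> + ((\<Sum>y\<in>T. ?H y h) - (\<Sum>y\<in>T. ?G y h)) / deg)"
    by simp
  also have "\<dots> = expectation (\<lambda>h. F h \<one>) + ((\<Sum>y\<in>T. expectation (?H y)) - (\<Sum>y\<in>T. expectation (?G y))) / deg"
    using T(2) int diagonal_integrable[OF F] by (subst Bochner_Integration.integral_add) (auto simp: subset_iff)
  finally show ?thesis
    using eq by simp
qed

lemma expectation_walkpow:
  assumes F: "diagonal F"
  shows "expectation (\<lambda>h. (walk deg (nb h) ^^ k) (F h) \<one>) = expectation (\<lambda>h. F h \<one>)"
proof (induction k)
  case (Suc k)
  then show ?case
    using expectation_walk[OF diagonal_walkpow[OF F, of k]] by simp
qed simp

text \<open>Each fixed time preserves the expectation; the series is nonnegative and can be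
  integrated termwise. The result does not depend on \<open>l\<close>.\<close>

lemma expectation_resolvent:
  assumes F: "diagonal F" and l: "0 < l" "l < 1"
  shows "expectation (\<lambda>h. resolvent deg (nb h) l (F h) \<one>) = expectation (\<lambda>h. F h \<one>)"
proof -
  let ?a = "\<lambda>k. l * (1 - l) ^ k"
  let ?W = "\<lambda>k h. (walk deg (nb h) ^^ k) (F h) \<one>"
  have W: "diagonal (\<lambda>h. (walk deg (nb h) ^^ k) (F h))" for k
    by (rule diagonal_walkpow[OF F])
  have W0: "\<bar>?a k * ?W k h\<bar> = ?a k * ?W k h" for k h
    using W[of k] l by (auto simp: diagonal_def)
  have E: "expectation (\<lambda>h. ?a k * ?W k h) = ?a k * expectation (\<lambda>h. F h \<one>)" for k
    using expectation_walkpow[OF F, of k] by simp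
  have sums: "(\<lambda>k. ?a k * expectation (\<lambda>h. F h \<one>)) sums (1 * expectation (\<lambda>h. F h \<one>))"
    by (rule sums_mult2[OF nb.weight_sums[OF l]])
  have "expectation (\<lambda>h. \<Sum>k. ?a k * ?W k h) = (\<Sum>k. expectation (\<lambda>h. ?a k * ?W k h))"
  proof (rule integral_suminf)
    show "integrable \<mu> (\<lambda>h. ?a k * ?W k h)" for k
      using diagonal_integrable[OF W] by simp
    show "AE h in \<mu>. summable (\<lambda>k. norm (?a k * ?W k h))"
      using nb.summable_resolvent[OF l, of "F _" 1] F by (auto simp: W0 diagonal_def)
    show "summable (\<lambda>k. expectation (\<lambda>h. norm (?a k * ?W k h)))"
      using sums by (simp only: real_norm_def W0 E) (rule sums_summable)
  qed
  also have "\<dots> = expectation (\<lambda>h. F h \<one>)"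
    using sums by (simp only: E) (simp add: sums_iff)
  finally show ?thesis
    by (simp add: resolvent_def)
qed

end

text \<open>The first Borel-Cantelli lemma with geometric bounds.\<close>

lemma (in finite_measure) AE_eventually_not:
  fixes P :: "nat \<Rightarrow> 'a \<Rightarrow> bool"
  assumes [measurable]: "\<And>n. Measurable.pred M (P n)" and le: "\<And>n. measure M {x\<in>space M. P n x} \<le> (1/2) ^ n"
  shows "AE x in M. \<forall>\<^sub>F n in sequentially. \<not> P n x"
proof -
  have "summable (\<lambda>n. measure M {x\<in>space M. P n x})"
    by (rule summable_comparison_test'[of "\<lambda>n. (1/2::real) ^ n"]) (use le in \<open>auto intro: summable_geometric\<close>)
  then have "AE x in M. \<forall>\<^sub>F n in sequentially. x \<in> space M - {x\<in>space M. P n x}"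
    by (intro borel_cantelli_AE1) (auto simp: emeasure_eq_measure)
  then show ?thesis
    by eventually_elim (auto elim: eventually_mono)
qed

lemma tendsto_0_of_eventually_le_power:
  fixes a :: "nat \<Rightarrow> real"
  assumes "\<And>n. 0 \<le> a n" "\<forall>\<^sub>F n in sequentially. a n \<le> (1/2) ^ n"
  shows "a \<longlonglongrightarrow> 0"
  by (rule tendsto_sandwich[OF _ assms(2) tendsto_const LIMSEQ_realpow_zero]) (use assms(1) in auto)

section \<open>Counting the positions that see a changed label\<close>

context percolation_map
begin

text \<open>The action on vertices is free, so \<open>y\<close> is determined by where one chosen
  vertex of \<open>i\<close> goes: one choice if \<open>e\<close> is a vertex, at most two if
  \<open>e\<close> is an edge.\<close>

lemma card_transporter:
  assumes i: "i \<in> sites \<Gamma> \<union> bonds \<Gamma> S" and e: "e \<in> sites \<Gamma> \<union> bonds \<Gamma> S"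
  shows "finite {y \<in> carrier \<Gamma>. act_element \<Gamma> (inv y) i = e}"
    "card {y \<in> carrier \<Gamma>. act_element \<Gamma> (inv y) i = e} \<le> 2"
proof -
  have "\<exists>Z. finite Z \<and> card Z \<le> 2 \<and> {y \<in> carrier \<Gamma>. act_element \<Gamma> (inv y) i = e} \<subseteq> Z"
  proof (cases i)
    case (Vertex x)
    then have x: "x \<in> carrier \<Gamma>" using i by (auto simp: sites_def bonds_def)
    have "y = inv x \<otimes> z" if "y \<in> carrier \<Gamma>" "act_element \<Gamma> (inv y) i = e" "e = Vertex z" for y z
      using that x Vertex by (auto simp: act_vertex_def simp flip: m_assoc)
    then show ?thesis
      using Vertex by (intro exI[of _ "case e of Vertex z \<Rightarrow> {inv x \<otimes> z} | Edge u \<Rightarrow> {}"]) (auto split: element.split)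
  next
    case (Edge u)
    then obtain x s where x: "x \<in> carrier \<Gamma>" "x \<in> u"
      using i by (auto simp: sites_def bonds_def cayley_edges_def)
    have y: "y \<in> (\<lambda>z. inv x \<otimes> z) ` v" if "y \<in> carrier \<Gamma>" "act_element \<Gamma> (inv y) i = e" "e = Edge v" for y v
    proof
      show "act (inv y) x \<in> v" using that x Edge by auto
      show "y = inv x \<otimes> act (inv y) x"
        using that(1) x(1) by (simp add: act_vertex_def flip: m_assoc)
    qed
    have v: "finite ((\<lambda>z. inv x \<otimes> z) ` v) \<and> card ((\<lambda>z. inv x \<otimes> z) ` v) \<le> 2" if "e = Edge v" for v
    proof -
      have "finite v \<and> card v \<le> 2"
        using that assms(2) by (auto simp: sites_def bonds_def cayley_edges_def card_insert_if)
      then show ?thesis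
        using card_image_le[of v "\<lambda>z. inv x \<otimes> z"] by auto
    qed
    show ?thesis
      using Edge y v
      by (intro exI[of _ "case e of Vertex z \<Rightarrow> {} | Edge v \<Rightarrow> (\<lambda>z. inv x \<otimes> z) ` v"])
        (simp split: element.split, blast)
  qed
  then obtain Z where Z: "finite Z" "card Z \<le> 2" "{y \<in> carrier \<Gamma>. act_element \<Gamma> (inv y) i = e} \<subseteq> Z"
    by blast
  then show "finite {y \<in> carrier \<Gamma>. act_element \<Gamma> (inv y) i = e}"
    "card {y \<in> carrier \<Gamma>. act_element \<Gamma> (inv y) i = e} \<le> 2"
    using finite_subset[OF Z(3,1)] card_mono[OF Z(1,3)] by auto
qed

text \<open>For a fixed set \<open>E\<close> of changed labels the bound is linear in the size of
  the window \<open>K\<close>; this is why the size of the window enters the weight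
  \<open>j\<close>.\<close>

lemma card_transporters:
  assumes K: "finite K" "K \<subseteq> J" and E: "finite E" "E \<subseteq> J"
  shows "finite {y \<in> carrier \<Gamma>. \<exists>i\<in>K. act_element \<Gamma> (inv y) i \<in> E}"
    "card {y \<in> carrier \<Gamma>. \<exists>i\<in>K. act_element \<Gamma> (inv y) i \<in> E} \<le> 2 * card K * card E"
proof -
  let ?Y = "\<lambda>(i, e). {y \<in> carrier \<Gamma>. act_element \<Gamma> (inv y) i = e}"
  have eq: "{y \<in> carrier \<Gamma>. \<exists>i\<in>K. act_element \<Gamma> (inv y) i \<in> E} = \<Union>(?Y ` (K \<times> E))"
    by auto
  have Y: "finite (?Y p)" "card (?Y p) \<le> 2" if "p \<in> K \<times> E" for p
    using that K(2) E(2) elements_sub(1) card_transporter[of "fst p" "snd p"] by (auto simp: split_beta subset_iff)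
  show "finite {y \<in> carrier \<Gamma>. \<exists>i\<in>K. act_element \<Gamma> (inv y) i \<in> E}"
    unfolding eq using K(1) E(1) Y(1) by blast
  have "card (\<Union>(?Y ` (K \<times> E))) \<le> (\<Sum>p\<in>K \<times> E. card (?Y p))"
    using K(1) E(1) by (intro card_UN_le) auto
  also have "\<dots> \<le> of_nat (card (K \<times> E)) * 2"
    using Y(2) by (intro sum_bounded_above) auto
  finally show "card {y \<in> carrier \<Gamma>. \<exists>i\<in>K. act_element \<Gamma> (inv y) i \<in> E} \<le> 2 * card K * card E"
    unfolding eq by (simp add: card_cartesian_product mult_ac)
qed

end

section \<open>Choice of the geometric parameters and almost sure limits\<close>

context stationary_percolation
begin

text \<open>On infinite clusters the diagonal Green function tends to 0 pointwise, hence in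
  probability. The weight \<open>j\<close> is given first and \<open>l\<close> is found
  afterwards.\<close>

lemma exists_small_green:
  fixes j e e' :: real
  assumes e: "0 < e" "0 < e'"
  shows "\<exists>l. 0 < l \<and> l \<le> 1/2 \<and>
    prob {h\<in>space \<mu>. infinite (C h \<one>) \<and> e < j * green deg (nb h) l \<one> \<one>} < e'"
proof -
  let ?l = "\<lambda>m::nat. 1 / (real m + 2)"
  define D where "D m = {h\<in>space \<mu>. infinite (C h \<one>) \<and> e < j * green deg (nb h) (?l m) \<one> \<one>}" for m
  \<comment> \<open>The events that the bound fails at some index from \<open>M\<close> on: they
    decrease, and pointwise convergence makes their intersection empty.\<close>
  define E where "E M = (\<Union>m\<in>{M..}. D m)" for M
  note [measurable] = pred_infinite_C measurable_green[OF one_closed]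
  have D: "D m \<in> events" for m
  proof -
    have "{h\<in>space L. infinite (C h \<one>) \<and> e < j * green deg (nb h) (?l m) \<one> \<one>} \<in> sets L"
      by measurable
    then show ?thesis by (simp add: D_def sets_\<mu> space_\<mu>)
  qed
  have "E (Suc M) \<subseteq> E M" for M
    unfolding E_def by (intro UN_mono) auto
  then have "(\<lambda>M. prob (E M)) \<longlonglongrightarrow> prob (\<Inter>M. E M)"
    using D by (intro finite_Lim_measure_decseq decseq_SucI) (auto simp: E_def)
  also have "(\<Inter>M. E M) = {}"
  proof -
    have "h \<notin> (\<Inter>M. E M)" for h
    proof
      assume h: "h \<in> (\<Inter>M. E M)"
      then have inf: "infinite (C h \<one>)"
        by (auto simp: E_def D_def)
      have "infinite {y. reach (nb h) \<one> y}"
        by (rule infinite_super[OF _ inf]) (auto intro: reach_C)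
      from tendsto_mult_right_zero[OF nb.green_diag_tendsto_0[OF this], of j]
      have "\<forall>\<^sub>F m in sequentially. j * green deg (nb h) (?l m) \<one> \<one> < e"
        using e(1) by (rule order_tendstoD)
      then obtain M where "\<forall>m\<ge>M. j * green deg (nb h) (?l m) \<one> \<one> < e"
        by (auto simp: eventually_sequentially)
      moreover have "h \<in> E M" using h by blast
      ultimately show False by (force simp: E_def D_def)
    qed
    then show ?thesis by blast
  qed
  finally have "\<forall>\<^sub>F M in sequentially. prob (E M) < e'"
    by (intro order_tendstoD) (use e in auto)
  then obtain M where M: "prob (E M) < e'"
    by (auto simp: eventually_sequentially)
  have "prob (D M) \<le> prob (E M)"
    using D by (intro finite_measure_mono) (auto simp: E_def)
  with M have "prob (D M) < e'" by simp
  then show ?thesis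
    unfolding D_def by (intro exI[of _ "?l M"]) auto
qed

text \<open>Stationarity keeps the expectation at \<open>(1/4) ^ n\<close>; Markov's inequality at
  level \<open>(1/2) ^ n\<close> leaves the summable bound \<open>(1/2) ^ n\<close>.\<close>

lemma AE_resolvent_tendsto_0:
  assumes F: "\<And>n. diagonal (F n)" and small: "\<And>n. expectation (\<lambda>h. F n h \<one>) \<le> (1/4) ^ n"
    and l: "\<And>n. 0 < l n" "\<And>n. l n \<le> 1/2"
  shows "AE h in \<mu>. (\<lambda>n. resolvent deg (nb h) (l n) (F n h) \<one>) \<longlonglongrightarrow> 0"
proof -
  let ?R = "\<lambda>n h. resolvent deg (nb h) (l n) (F n h) \<one>"
  have l1: "l n < 1" for n using l(2)[of n] by simp
  have R: "0 \<le> ?R n h" "?R n h \<le> 1" for n h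
    using F[of n] by (auto simp: diagonal_def intro!: nb.resolvent_nonneg[OF l(1) l1, of _ 1] nb.resolvent_le[OF l(1) l1])
  have m: "?R n \<in> borel_measurable \<mu>" for n
    unfolding measurable_cong_sets[OF sets_\<mu> refl]
    using F[of n] by (intro measurable_resolvent) (auto simp: diagonal_def)
  note [measurable] = m
  have "AE h in \<mu>. \<forall>\<^sub>F n in sequentially. \<not> (1/2) ^ n \<le> ?R n h"
  proof (rule AE_eventually_not)
    show "Measurable.pred \<mu> (\<lambda>h. (1/2) ^ n \<le> ?R n h)" for n
      by measurable
    fix n
    have "integrable \<mu> (?R n)"
      by (rule integrable_const_bound[of _ 1]) (use R m in auto)
    then have "prob {h\<in>space \<mu>. (1/2) ^ n \<le> ?R n h} \<le> expectation (?R n) / (1/2) ^ n"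
      by (rule integral_Markov_inequality_measure[where A = "{}"]) (use R in auto)
    also have "expectation (?R n) \<le> (1/4) ^ n"
      using expectation_resolvent[OF F l(1) l1] small by simp
    then have "expectation (?R n) / (1/2) ^ n \<le> (1/4) ^ n / (1/2) ^ n"
      by (intro divide_right_mono) auto
    also have "\<dots> = (1/2::real) ^ n"
      by (simp flip: power_divide)
    finally show "prob {h\<in>space \<mu>. (1/2) ^ n \<le> ?R n h} \<le> (1/2) ^ n" .
  qed
  then show ?thesis
  proof eventually_elim
    case (elim h)
    show ?case
      by (rule tendsto_0_of_eventually_le_power[OF R(1)]) (use elim in \<open>auto elim!: eventually_mono\<close>)
  qed
qed

lemma AE_green_tendsto_0:
  assumes small: "\<And>n. prob {h\<in>space \<mu>. infinite (C h \<one>) \<and> (1/2) ^ n < j n * green deg (nb h) (l n) \<one> \<one>} \<le> (1/2) ^ n"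
    and l: "\<And>n. 0 < l n" "\<And>n. l n \<le> 1/2" and j: "\<And>n. (0::real) \<le> j n"
  shows "AE h in \<mu>. infinite (C h \<one>) \<longrightarrow> (\<lambda>n. j n * green deg (nb h) (l n) \<one> \<one>) \<longlonglongrightarrow> 0"
proof -
  note [measurable] = pred_infinite_C measurable_green[OF one_closed]
  have "Measurable.pred L (\<lambda>h. infinite (C h \<one>) \<and> (1/2) ^ n < j n * green deg (nb h) (l n) \<one> \<one>)" for n
    by measurable
  then have "Measurable.pred \<mu> (\<lambda>h. infinite (C h \<one>) \<and> (1/2) ^ n < j n * green deg (nb h) (l n) \<one> \<one>)" for n
    by (simp add: measurable_cong_sets[OF sets_\<mu> refl])
  from AE_eventually_not[OF this small] show ?thesis
  proof eventually_elim
    case (elim h)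
    have l1: "l n < 1" for n using l(2)[of n] by simp
    have "0 \<le> j n * green deg (nb h) (l n) \<one> \<one>" for n
      using j nb.green_nonneg[OF l(1) l1] by (intro mult_nonneg_nonneg) auto
    then show ?case
      using elim by (auto intro!: tendsto_0_of_eventually_le_power elim!: eventually_mono)
  qed
qed

section \<open>Tail representatives\<close>

text \<open>Agreement with \<open>A\<close> is first proved at the identity and then moved to the
  other vertices by invariance of the law.\<close>

lemma essentially_tail_representative:
  assumes A: "component_property \<Gamma> S J I \<Phi> A"
  shows "\<exists>A'. tail_component_property \<Gamma> S J I \<Phi> A' \<and>
    (\<forall>x\<in>carrier \<Gamma>. AE h in \<mu>. (h, x) \<in> A \<longleftrightarrow> (h, x) \<in> A')"
proof -
  have A_sets: "A \<in> sets (L \<Otimes>\<^sub>M count_space (carrier \<Gamma>))"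
    and A_tr: "\<And>g h v. g \<in> carrier \<Gamma> \<Longrightarrow> h \<in> space L \<Longrightarrow> v \<in> carrier \<Gamma> \<Longrightarrow>
      (tr g h, act g v) \<in> A \<longleftrightarrow> (h, v) \<in> A"
    and A_C: "\<And>h v w. h \<in> space L \<Longrightarrow> w \<in> C h v \<Longrightarrow> (h, v) \<in> A \<longleftrightarrow> (h, w) \<in> A"
    using A C_carrier unfolding component_property_def C_def by blast+
  have A_pred [measurable]: "Measurable.pred L (\<lambda>h. (h, v) \<in> A)" for v
  proof -
    have "{h \<in> space L. (h, v) \<in> A} = (\<lambda>h. (h, v)) -` A"
      using sets.sets_into_space[OF A_sets] by (auto simp: space_pair_measure)
    then show ?thesis
      using sets_Pair2[OF A_sets, of v] by (simp add: pred_def)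
  qed
  let ?A1 = "{h\<in>space L. (h, \<one>) \<in> A}"
  have "\<forall>n. \<exists>K B. finite K \<and> K \<subseteq> J \<and> B \<in> sets \<mu> \<and>
    (\<forall>x\<in>space \<mu>. \<forall>y\<in>space \<mu>. (\<forall>i\<in>K. x i = y i) \<longrightarrow> (x \<in> B \<longleftrightarrow> y \<in> B)) \<and>
    prob ((?A1 - B) \<union> (B - ?A1)) < (1/4) ^ n" (is "\<forall>n. \<exists>K B. ?P n K B")
    by (intro allI finite_coordinates_approximation[of _ J "\<lambda>_. borel"])
      (use A_pred in \<open>auto simp: sets_\<mu> labellings_def pred_def intro: finite_measure_axioms\<close>)
  from choice[OF this] obtain K where "\<forall>n. \<exists>B. ?P n (K n) B" ..
  from choice[OF this] obtain B where P: "\<forall>n. ?P n (K n) (B n)" ..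
  have K: "finite (K n)" "K n \<subseteq> J" for n
    using P by blast+
  have B: "B n \<in> sets L" and AB: "prob ((?A1 - B n) \<union> (B n - ?A1)) < (1/4) ^ n" for n
    using P[THEN spec, of n] unfolding sets_\<mu> by - (elim conjE, assumption)+
  have "\<forall>x\<in>space L. \<forall>y\<in>space L. (\<forall>i\<in>K n. x i = y i) \<longrightarrow> (x \<in> B n \<longleftrightarrow> y \<in> B n)" for n
    using P[THEN spec, of n] unfolding space_\<mu> by (elim conjE)
  note KB = this[THEN bspec, THEN bspec, THEN mp]
  \<comment> \<open>As \<open>tr y\<close> takes \<open>y\<close> to the identity,
    \<open>tr y h \<in> B n\<close> is the approximating event seen from \<open>y\<close>.
    \<open>F\<close> marks its wrong predictions; \<open>f\<close> below marks its failure without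
    mentioning \<open>A\<close>, so it depends on finitely many labels.\<close>
  define F where "F n h y = (if (tr y h \<in> B n) \<noteq> ((h, y) \<in> A) then 1 else 0 :: real)" for n h y
  define f where "f n h y = (if tr y h \<notin> B n then 1 else 0 :: real)" for n h y
  define j where "j n = real (card (K n)) + 1" for n
  have j: "1 \<le> j n" for n by (simp add: j_def)
  have f01: "0 \<le> f n h y \<and> f n h y \<le> 1" for n h y by (simp add: f_def)
  have trB: "Measurable.pred L (\<lambda>h. tr y h \<in> B n)" if "y \<in> carrier \<Gamma>" for n y
    using measurable_tr[OF that] B[of n] by measurable
  have f_meas: "(\<lambda>h. f n h y) \<in> borel_measurable L" if "y \<in> carrier \<Gamma>" for n y
    unfolding f_def using trB[OF that, of n] by measurable
  have F_meas: "(\<lambda>h. F n h y) \<in> borel_measurable L" if "y \<in> carrier \<Gamma>" for n y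
    unfolding F_def using trB[OF that, of n] by measurable
  have f_tr: "f n (tr g h) (act g y) = f n h y" if "g \<in> carrier \<Gamma>" "y \<in> carrier \<Gamma>" for n g h y
    using that by (simp add: f_def tr_act)
  have F: "diagonal (F n)" for n
    unfolding diagonal_def using F_meas by (auto simp: F_def tr_act A_tr)
  have F_small: "expectation (\<lambda>h. F n h \<one>) \<le> (1/4) ^ n" for n
  proof -
    let ?D = "(?A1 - B n) \<union> (B n - ?A1)"
    have "expectation (\<lambda>h. F n h \<one>) = expectation (indicator ?D)"
      by (intro Bochner_Integration.integral_cong refl) (auto simp: space_\<mu> F_def tr_one indicator_def)
    also have "?D \<subseteq> space \<mu>"
      using sets.sets_into_space[OF B[of n]] by (auto simp: space_\<mu>)
    then have "expectation (indicator ?D) = prob ?D"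
      by (simp add: Int_absorb2)
    finally show ?thesis using AB[of n] by simp
  qed
  \<comment> \<open>The parameter is chosen after the window \<open>K n\<close>, whose size enters
    through \<open>j n\<close>.\<close>
  have "\<forall>n. \<exists>l. 0 < l \<and> l \<le> 1/2 \<and>
    prob {h\<in>space \<mu>. infinite (C h \<one>) \<and> (1/2) ^ n < j n * green deg (nb h) l \<one> \<one>} < (1/2) ^ n"
    by (intro allI exists_small_green) auto
  from choice[OF this] obtain l where *: "\<forall>n. 0 < l n \<and> l n \<le> 1/2 \<and>
    prob {h\<in>space \<mu>. infinite (C h \<one>) \<and> (1/2) ^ n < j n * green deg (nb h) (l n) \<one> \<one>} < (1/2) ^ n" ..
  then have l: "0 < l n" "l n \<le> 1/2" for n
    by blast+
  have l_small: "prob {h\<in>space \<mu>. infinite (C h \<one>) \<and> (1/2) ^ n < j n * green deg (nb h) (l n) \<one> \<one>} < (1/2) ^ n" for n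
    using * by blast
  have l1: "l n < 1" for n using l(2)[of n] by simp

  \<comment> \<open>A tail property must be stable for every labelling, not just almost every one.
    Hence the Green condition is part of \<open>R\<close>, although it holds almost surely on
    infinite clusters.\<close>
  define R where "R h v \<longleftrightarrow> vanishing deg (nb h) l j (\<lambda>n. f n h) v" for h v
  have R_pred: "Measurable.pred L (\<lambda>h. R h v)" if v: "v \<in> carrier \<Gamma>" for v
  proof -
    have [measurable]: "(\<lambda>h. green deg (nb h) (l n) v v) \<in> borel_measurable L"
      "(\<lambda>h. resolvent deg (nb h) (l n) (f n h) v) \<in> borel_measurable L" for n
      using v by (auto intro: measurable_green measurable_resolvent f_meas)
    show ?thesis
      unfolding R_def vanishing_def by measurable
  qed
  have R_tr: "R (tr g h) (act g v) \<longleftrightarrow> R h v"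
    if "g \<in> carrier \<Gamma>" "h \<in> space L" "v \<in> carrier \<Gamma>" for g h v
  proof -
    have "resolvent deg (nb (tr g h)) (l n) (f n (tr g h)) (act g v) = resolvent deg (nb h) (l n) (f n h) v" for n
      using that by (intro resolvent_tr f_tr)
    then show ?thesis
      using that by (simp add: R_def vanishing_def green_tr)
  qed
  have R_C: "R h w" if "w \<in> C h v" "R h v" for h v w
    using that(2) unfolding R_def
    by (rule nb.vanishing_reach[of l j "\<lambda>n. f n h", OF l j f01 reach_C[OF that(1)]])
  \<comment> \<open>Finite clusters keep their type, since the tail condition concerns infinite
    clusters only.\<close>
  define A' where "A' = {(h, v). h \<in> space L \<and> v \<in> carrier \<Gamma> \<and> (if infinite (C h v) then R h v else (h, v) \<in> A)}"
  have A': "(h, v) \<in> A' \<longleftrightarrow> (if infinite (C h v) then R h v else (h, v) \<in> A)"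
    if "h \<in> space L" "v \<in> carrier \<Gamma>" for h v
    using that by (simp add: A'_def)
  have comp: "component_property \<Gamma> S J I \<Phi> A'"
    unfolding component_property_def
  proof (intro conjI ballI)
    let ?X = "\<lambda>v. {h \<in> space L. if infinite (C h v) then R h v else (h, v) \<in> A}"
    have eq: "A' = (\<Union>v\<in>carrier \<Gamma>. ?X v \<times> {v})"
      by (auto simp: A'_def)
    have X: "?X v \<in> sets L" if "v \<in> carrier \<Gamma>" for v
      using R_pred[OF that] pred_infinite_C[of v] A_pred[of v] by measurable
    show "A' \<in> sets (L \<Otimes>\<^sub>M count_space (carrier \<Gamma>))"
      unfolding eq by (rule sets.countable_UN''[OF countable_carrier], rule pair_measureI[OF X]) auto
  next
    fix g h v assume g: "g \<in> carrier \<Gamma>" and h: "h \<in> space L" and v: "v \<in> carrier \<Gamma>"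
    have "inj_on (act g) (C h v)"
      using inj_act[OF g] C_sub by (rule inj_on_subset)
    then show "(tr g h, act g v) \<in> A' \<longleftrightarrow> (h, v) \<in> A'"
      using g h v by (simp add: A' space_tr C_tr finite_image_iff R_tr A_tr)
  next
    fix h v w assume h: "h \<in> space L" and v: "v \<in> carrier \<Gamma>" and "w \<in> cluster \<Gamma> S I (\<Phi> h) v"
    then have w: "w \<in> C h v" by (simp add: C_def)
    have "w \<in> carrier \<Gamma>" using w C_sub by blast
    then show "(h, v) \<in> A' \<longleftrightarrow> (h, w) \<in> A'"
      using h v C_eq[OF w] A_C[OF h w] R_C[OF w] R_C[OF C_sym[OF w]] by (auto simp: A')
  qed
  have R_tail: "R h' \<one>"
    if h: "h \<in> space L" "h' \<in> space L" and fin: "finite {i\<in>J. h i \<noteq> h' i}"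
      and inf: "infinite (C h \<one>)" "infinite (C h' \<one>)"
      and diff: "finite ((C h \<one> - C h' \<one>) \<union> (C h' \<one> - C h \<one>))" and R: "R h \<one>" for h h'
  proof -
    let ?E = "{i\<in>J. h i \<noteq> h' i}"
    \<comment> \<open>The positions whose window \<open>K n\<close> meets a changed label. Elsewhere
      \<open>f n\<close> takes the same value for both labellings.\<close>
    let ?Z = "\<lambda>n. {y \<in> carrier \<Gamma>. \<exists>i\<in>K n. act_element \<Gamma> (inv y) i \<in> ?E}"
    have "\<one> \<in> C h \<one>" "\<one> \<in> C h' \<one>"
      using inf C_refl by (metis finite.emptyI ex_in_conv)+
    then interpret P: graph_pair "nb h" "nb h'" deg "C h \<one> \<inter> C h' \<one>"
      "insert \<one> (((C h \<one> - C h' \<one>) \<union> (C h' \<one> - C h \<one>)) \<union> (\<lambda>(s, z). inv s \<otimes> z) ` (T \<times> ((C h \<one> - C h' \<one>) \<union> (C h' \<one> - C h \<one>))))" \<one>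
      using graph_pair_nb diff by blast
    have Z: "finite (?Z n)" "card (?Z n) \<le> 2 * card (K n) * card ?E" for n
      using card_transporters[OF K fin] by auto
    show ?thesis
      unfolding R_def
    proof (rule P.vanishing_compare[of l j "\<lambda>n. f n h" "\<lambda>n. f n h'", OF l j f01 f01 Z(1)])
      show "real (card (?Z n)) \<le> (2 * real (card ?E)) * j n" for n
      proof -
        have "real (card (?Z n)) \<le> real (2 * card (K n) * card ?E)"
          using Z(2) by (simp only: of_nat_le_iff)
        also have "\<dots> \<le> (2 * real (card ?E)) * j n"
          by (simp add: j_def algebra_simps)
        finally show ?thesis .
      qed
      show "f n h y = f n h' y" if "y \<in> C h \<one> \<inter> C h' \<one>" "y \<notin> ?Z n" for n y
      proof -
        have y: "y \<in> carrier \<Gamma>" using that(1) C_sub by blast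
        have "\<forall>i\<in>K n. tr y h i = tr y h' i"
        proof
          fix i assume i: "i \<in> K n"
          then have "i \<in> J" using K(2) by blast
          moreover have "act_element \<Gamma> (inv y) i \<in> J"
            using act_closed(2)[of "inv y" i] y \<open>i \<in> J\<close> by simp
          ultimately show "tr y h i = tr y h' i"
            using that(2) i y by (auto simp: translate_def)
        qed
        from KB[OF space_tr[OF y h(1)] space_tr[OF y h(2)] this] show ?thesis
          by (simp add: f_def)
      qed
      show "vanishing deg (nb h) l j (\<lambda>n. f n h) \<one>"
        using R by (simp add: R_def)
    qed
  qed
  have tail: "tail_component_property \<Gamma> S J I \<Phi> A'"
    unfolding tail_component_property_def Let_def C_def[symmetric]
  proof (intro conjI comp ballI impI)
    fix h h' assume h: "h \<in> space L" "h' \<in> space L"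
      and *: "finite {i\<in>J. h i \<noteq> h' i} \<and> infinite (C h \<one>) \<and> infinite (C h' \<one>)
        \<and> finite ((C h \<one> - C h' \<one>) \<union> (C h' \<one> - C h \<one>))"
    then have sym: "finite {i\<in>J. h' i \<noteq> h i}" "finite ((C h' \<one> - C h \<one>) \<union> (C h \<one> - C h' \<one>))"
      by (simp_all add: eq_commute Un_commute)
    have "R h \<one> \<longleftrightarrow> R h' \<one>"
      using R_tail[OF h] R_tail[OF h(2,1) sym(1) _ _ sym(2)] * by blast
    then show "(h, \<one>) \<in> A' \<longleftrightarrow> (h', \<one>) \<in> A'"
      using h * by (simp add: A')
  qed

  have AE_one: "AE h in \<mu>. (h, \<one>) \<in> A \<longleftrightarrow> (h, \<one>) \<in> A'"
  proof -
    have "AE h in \<mu>. (\<lambda>n. resolvent deg (nb h) (l n) (F n h) \<one>) \<longlonglongrightarrow> 0"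
      by (rule AE_resolvent_tendsto_0[OF F F_small l])
    moreover have "AE h in \<mu>. infinite (C h \<one>) \<longrightarrow> (\<lambda>n. j n * green deg (nb h) (l n) \<one> \<one>) \<longlonglongrightarrow> 0"
      by (rule AE_green_tendsto_0[OF less_imp_le[OF l_small] l]) (simp add: j_def)
    ultimately show ?thesis
      using AE_space
    proof eventually_elim
      case (elim h)
      then have h: "h \<in> space L" by (simp add: space_\<mu>)
      let ?U = "\<lambda>f n. resolvent deg (nb h) (l n) (f n) \<one>"
      show ?case
      proof (cases "infinite (C h \<one>)")
        case inf: True
        have one: "\<one> \<in> C h \<one>"
          using inf C_refl by (metis finite.emptyI ex_in_conv)
        have closed: "nb h x \<subseteq> C h \<one>" if "x \<in> C h \<one>" for x
          using nb_subset(1)[of h x] C_eq[OF that] by simp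
        have U_cong: "?U g n = ?U g' n" if "\<And>x. x \<in> C h \<one> \<Longrightarrow> g n x = g' n x" for g g' n
          by (rule nb.resolvent_cong_closed[OF l(1) l1 that closed one])
        have "R h \<one> \<longleftrightarrow> (\<lambda>n. ?U (\<lambda>n. f n h) n) \<longlonglongrightarrow> 0"
          using elim inf by (simp add: R_def vanishing_def)
        \<comment> \<open>The type is constant on the cluster, so there \<open>f\<close> equals
          \<open>F\<close> if the type is \<open>A\<close> and \<open>1 - F\<close> otherwise. The
          averages of \<open>f\<close> tend to 0 or 1 accordingly.\<close>
        also have "\<dots> \<longleftrightarrow> (h, \<one>) \<in> A"
        proof (cases "(h, \<one>) \<in> A")
          case True
          have "?U (\<lambda>n. f n h) n = ?U (\<lambda>n. F n h) n" for n
            by (rule U_cong) (use True A_C[OF h] in \<open>auto simp: f_def F_def\<close>)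
          then show ?thesis using True elim by simp
        next
          case False
          have "?U (\<lambda>n. f n h) n = 1 - ?U (\<lambda>n. F n h) n" for n
          proof -
            have "?U (\<lambda>n. f n h) n + ?U (\<lambda>n. F n h) n = resolvent deg (nb h) (l n) (\<lambda>x. f n h x + F n h x) \<one>"
              by (rule nb.resolvent_add[OF l(1) l1, of _ 1 _ 1, symmetric]) (auto simp: f_def F_def)
            also have "\<dots> = resolvent deg (nb h) (l n) (\<lambda>_. 1) \<one>"
              by (rule nb.resolvent_cong_closed[OF l(1) l1 _ closed one])
                (use False A_C[OF h] in \<open>auto simp: f_def F_def\<close>)
            finally show ?thesis
              by (simp add: nb.resolvent_const[OF l(1) l1])
          qed
          moreover have "(\<lambda>n. 1 - ?U (\<lambda>n. F n h) n) \<longlonglongrightarrow> 1 - 0"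
            using elim by (intro tendsto_diff tendsto_const) simp
          ultimately have "(\<lambda>n. ?U (\<lambda>n. f n h) n) \<longlonglongrightarrow> 1"
            by simp
          then show ?thesis
            using False LIMSEQ_unique by fastforce
        qed
        finally show ?thesis
          using inf h by (simp add: A')
      qed (use h in \<open>simp add: A'\<close>)
    qed
  qed
  have "AE h in \<mu>. (h, x) \<in> A \<longleftrightarrow> (h, x) \<in> A'" if x: "x \<in> carrier \<Gamma>" for x
  proof -
    have m: "tr x \<in> \<mu> \<rightarrow>\<^sub>M L"
      using measurable_tr[OF x] by (simp add: measurable_cong_sets[OF sets_\<mu> refl])
    \<comment> \<open>Translation by \<open>x\<close> preserves the law and takes \<open>x\<close>
      to the identity.\<close>
    have "AE h in distr \<mu> L (tr x). (h, \<one>) \<in> A \<longleftrightarrow> (h, \<one>) \<in> A'"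
      unfolding invariant[OF x] by (rule AE_one)
    from AE_distrD[OF m this] AE_space show ?thesis
    proof eventually_elim
      case (elim h)
      then have h: "h \<in> space L" by (simp add: space_\<mu>)
      have "(tr x h, act x x) \<in> A' \<longleftrightarrow> (h, x) \<in> A'"
        using comp x h unfolding component_property_def by blast
      with elim A_tr[OF x h x] show ?case
        using x by simp
    qed
  qed
  with tail show ?thesis by blast
qed

end

section \<open>From the law of the labelling back to the probability space\<close>

theorem theorem1p5:
  fixes \<Gamma> :: "('a, 'b) monoid_scheme"
    and S :: "'a set"
    and J I :: "'a element set"
    and M :: "'m measure"
    and \<eta> :: "'m \<Rightarrow> 'a element \<Rightarrow> 'l::polish_space"
    and \<omega> :: "'m \<Rightarrow> 'a element \<Rightarrow> bool"
    and \<Phi> :: "('a element \<Rightarrow> 'l) \<Rightarrow> 'a element \<Rightarrow> bool"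
  assumes "group \<Gamma>"
    and "finite S" "S \<subseteq> carrier \<Gamma>" "generate \<Gamma> S = carrier \<Gamma>"
    and "J \<in> {sites \<Gamma>, bonds \<Gamma> S, sites \<Gamma> \<union> bonds \<Gamma> S}"
    and "I \<in> {sites \<Gamma>, bonds \<Gamma> S}"
    and "prob_space M"
    and "\<eta> \<in> M \<rightarrow>\<^sub>M labellings J"
    and "invariant_labelling \<Gamma> J M \<eta>"
    and "ergodic_labelling \<Gamma> J M \<eta>"
    and "\<omega> \<in> M \<rightarrow>\<^sub>M configurations I"
    and "jointly_invariant \<Gamma> J I M \<eta> \<omega>"
    and "equivariant_representative \<Gamma> J I M \<eta> \<omega> \<Phi>"
  shows "\<not> (\<exists>A. component_property \<Gamma> S J I \<Phi> A
            \<and> nontrivial_property \<Gamma> S I M \<eta> \<omega> A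
            \<and> \<not> essentially_tail \<Gamma> S J I M \<eta> \<Phi> A)"
proof -
  interpret M: prob_space M by fact
  \<comment> \<open>The preceding results treat the labelling itself as the sample point, so they
    are applied to its law.\<close>
  let ?\<mu> = "distr M (labellings J) \<eta>"
  interpret \<mu>: prob_space ?\<mu>
    by (rule M.prob_space_distr) fact
  interpret group \<Gamma> by fact
  interpret percolation_map \<Gamma> S J I \<Phi>
    using assms by unfold_locales (auto simp: equivariant_representative_def)
  interpret stationary_percolation \<Gamma> S J I \<Phi> ?\<mu>
  proof
    fix g assume g: "g \<in> carrier \<Gamma>"
    have "distr ?\<mu> (labellings J) (translate \<Gamma> J g) = distr M (labellings J) (\<lambda>s. translate \<Gamma> J g (\<eta> s))"
      using measurable_tr[OF g] assms(8) by (simp add: distr_distr comp_def)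
    also have "\<dots> = ?\<mu>"
      using assms(9) g by (simp add: invariant_labelling_def)
    finally show "distr ?\<mu> (labellings J) (translate \<Gamma> J g) = ?\<mu>" .
  qed simp
  have "essentially_tail \<Gamma> S J I M \<eta> \<Phi> A" if A: "component_property \<Gamma> S J I \<Phi> A" for A
  proof -
    obtain A' where A': "tail_component_property \<Gamma> S J I \<Phi> A'"
      and AE: "\<And>x. x \<in> carrier \<Gamma> \<Longrightarrow> AE h in ?\<mu>. (h, x) \<in> A \<longleftrightarrow> (h, x) \<in> A'"
      using essentially_tail_representative[OF A] by blast
    have "\<P>(s in M. (\<eta> s, x) \<in> (A - A') \<union> (A' - A)) = 0" if x: "x \<in> carrier \<Gamma>" for x
    proof (subst M.prob_Collect_eq_0)
      have "(\<lambda>s. (\<eta> s, x)) \<in> M \<rightarrow>\<^sub>M labellings J \<Otimes>\<^sub>M count_space (carrier \<Gamma>)"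
        using x assms(8) by (intro measurable_Pair measurable_const) auto
      moreover have "(A - A') \<union> (A' - A) \<in> sets (labellings J \<Otimes>\<^sub>M count_space (carrier \<Gamma>))"
        using A A' by (auto simp: tail_component_property_def component_property_def)
      ultimately show "{s \<in> space M. (\<eta> s, x) \<in> (A - A') \<union> (A' - A)} \<in> sets M"
        by (auto dest!: measurable_sets simp: vimage_def Int_def conj_commute)
      show "AE s in M. (\<eta> s, x) \<notin> (A - A') \<union> (A' - A)"
        using AE_distrD[OF assms(8) AE[OF x]] by eventually_elim auto
    qed
    with A' show ?thesis
      unfolding essentially_tail_def by blast
  qed
  then show ?thesis by blast
qed

end
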